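(* Let $r\ge 1$. Let the prior distribution of the change point $\nu$ satisfy, for some $0\le\mu<\infty$, $$\lim_{n\to\infty}\frac{|\log(1-\Pi_n)|}{n}=\mu,$$ and, in the case $\mu=0$, assume in addition that $\sum_{k=0}^\infty \pi_k|\log\pi_k|^r<\infty$. Assume that for some $0<I<\infty$ $$\sum_{k=0}^\infty\pi_k\Big[\sum_{n=1}^\infty n^{r-1}\mathsf{P}_k\Big(\Big|\frac1n\lambda_{k+n}^k-I\Big|>\varepsilon\Big)\Big]<\infty\quad\text{for all }\varepsilon>0.$$ Let $T_A$ be the Shiryaev procedure. Then for all $0<m\le r$ $$\lim_{A\to\infty}\frac{\mathsf{E}^\pi[(T_A-\nu)^m\mid T_A>\nu]}{(\log A)^m}=\frac1{(I+\mu)^m},$$ and, with $A_\alpha=(1-\alpha)/\alpha$, $0<\alpha<1-q$, for all $0<m\le r$ $$\lim_{\alpha\to0}\frac{\inf_{T\in\mathbb{C}_\alpha}\mathsf{E}^\pi[(T-\nu)^m\mid T>\nu]}{\mathsf{E}^\pi[(T_{A_\alpha}-\nu)^m\mid T_{A_\alpha}>\nu]}=1$$ and $$\inf_{T\in\mathbb{C}_\alpha}\mathsf{E}^\pi[(T-\nu)^m\mid T>\nu]\sim\mathsf{E}^\pi[(T_{A_\alpha}-\nu)^m\mid T_{A_\alpha}>\nu]\sim\Big(\frac{|\log\alpha|}{I+\mu}\Big)^m\quad\text{as }\alpha\to0.$$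
   Context: Model. $\mathbb{Z}_+=\{0,1,2,\dots\}$. Observations $X_1,X_2,\dots$ are random variables on a measurable space $(\Omega,\mathscr{F})$; $\mathbf{X}^n=(X_1,\dots,X_n)$, $\mathscr{F}_n=\sigma(\mathbf{X}^n)$. $\mathsf{P}_\infty$ (no change) and $\mathsf{P}_0$ are probability measures whose restrictions to $\mathscr{F}_n$ are mutually absolutely continuous for every $n\ge1$, with conditional densities $p_j(X_i|\mathbf{X}^{i-1})$, $j=\infty,0$, with respect to a $\sigma$-finite measure (these may depend on $i$, and $p_0(X_i|\mathbf{X}^{i-1})$ for $i>\nu$ may also depend on the change point $\nu$; this dependence is suppressed in the notation). No independence or identical distribution is assumed. For $k\in\mathbb{Z}_+$, $\mathsf{P}_k$ (expectation $\mathsf{E}_k$) is the measure when the change point is $\nu=k$ ($k$ is the index of the last pre-change observation), under which $\mathbf{X}^n$ has density $\prod_{i=1}^{k}p_\infty(X_i|\mathbf{X}^{i-1})\prod_{i=k+1}^n p_0(X_i|\mathbf{X}^{i-1})$ for $n>k$ and $\prod_{i=1}^n p_\infty(X_i|\mathbf{X}^{i-1})$ for $n\le k$. Prior. The change point $\nu$ is integer valued with prior $\Pi_n=\mathsf{P}(\nu\le n)$, $\pi_k=\mathsf{P}(\nu=k)$ for $k\in\mathbb{Z}_+$, $q=\mathsf{P}(\nu<0)\in[0,1)$ (the prior on negative integers matters only through $q$). Terms $\pi_k|\log\pi_k|^r$ with $\pi_k=0$ are $0$. Log-likelihood ratios. $\mathcal{L}_i=p_0(X_i|\mathbf{X}^{i-1})/p_\infty(X_i|\mathbf{X}^{i-1})$,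 $Z_i=\log\mathcal{L}_i$, $\lambda_{k+n}^k=\sum_{i=k+1}^{k+n}Z_i$ for $n\ge1$. Detection procedures. A detection procedure is a stopping time $T\geq 1$ (possibly infinite) with respect to $\{\mathscr{F}_n\}$. Its weighted probability of false alarm is $\mathsf{PFA}(T)=\sum_{k=1}^\infty\pi_k\mathsf{P}_\infty(T\le k)$, and $\mathbb{C}_\alpha=\{T:\mathsf{PFA}(T)\le\alpha\}$ for $0<\alpha<1$. With $\mathsf{P}^\pi(\mathcal{A}\times J)=\sum_{k\in J}\pi_k\mathsf{P}_k(\mathcal{A})$ for $J\subseteq\mathbb{Z}_+$, the conditional moments of the delay are $\mathsf{E}^\pi[(T-\nu)^m\mid T>\nu]=\sum_{k\ge0}\pi_k\mathsf{E}_k[((T-k)^+)^m]\big/\sum_{k\ge0}\pi_k\mathsf{P}_\infty(T>k)$. Shiryaev procedure. $T_A=\inf\{n\ge1:\Lambda_n\ge A\}$, $A>q/(1-q)$, where $\Lambda_n=\frac1{\mathsf{P}(\nu\ge n)}\big(q\prod_{i=1}^n\mathcal{L}_i+\sum_{k=0}^{n-1}\pi_k\prod_{i=k+1}^n\mathcal{L}_i\big)$. $f\sim g$ means that the ratio $f/g$ tends to $1$. *)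

theory Defs
  imports "HOL-Probability.Probability"
begin

section \<open>Observations and the change-point model\<close>

definition history :: "(nat \<Rightarrow> 'w \<Rightarrow> 's) \<Rightarrow> nat \<Rightarrow> 'w \<Rightarrow> nat \<Rightarrow> 's" where
  "history X n \<omega> = (\<lambda>i\<in>{1..n}. X i \<omega>)"

definition obs_algebra ::
  "'w measure \<Rightarrow> 's measure \<Rightarrow> (nat \<Rightarrow> 'w \<Rightarrow> 's) \<Rightarrow> nat \<Rightarrow> 'w measure" where
  "obs_algebra M N X n = vimage_algebra (space M) (history X n) (\<Pi>\<^sub>M i\<in>{1..n}. N)"

text \<open>The joint density of the first \<open>n\<close> observations when \<open>k\<close> is the index of the last pre-change
  observation.  Here \<open>g i h x\<close> is the pre-change conditional density \<open>p\<^sub>\<infinity>(x | h)\<close> of the \<open>i\<close>-th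
  observation given the history \<open>h\<close> of the first \<open>i - 1\<close> ones, and \<open>f k i h x\<close> is the post-change one,
  which may depend on the change point \<open>k\<close>.  For \<open>n \<le> k\<close> the second product is empty.\<close>

definition joint_density ::
  "(nat \<Rightarrow> (nat \<Rightarrow> 's) \<Rightarrow> 's \<Rightarrow> real) \<Rightarrow> (nat \<Rightarrow> nat \<Rightarrow> (nat \<Rightarrow> 's) \<Rightarrow> 's \<Rightarrow> real)
    \<Rightarrow> nat \<Rightarrow> nat \<Rightarrow> (nat \<Rightarrow> 's) \<Rightarrow> real" where
  "joint_density g f k n x =
     (\<Prod>i\<in>{1..min k n}. g i (restrict x {1..i - 1}) (x i)) *
     (\<Prod>i\<in>{k + 1..n}. f k i (restrict x {1..i - 1}) (x i))"

text \<open>\<open>M\<close> is used only as the measurable space \<open>(\<Omega>, \<F>)\<close>; \<open>N\<close> is the state space of the observations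
  together with the dominating measure; \<open>P k\<close> is the measure under the change point \<open>k \<ge> 0\<close>.  That
  \<open>g i h\<close> and \<open>f k i h\<close> integrate to one for almost every history \<open>h\<close> follows from the joint density
  assumptions for \<open>i - 1\<close> and \<open>i\<close>.  Since the post-change densities may depend on the change
  point, mutual absolute continuity is required for each \<open>P k\<close>; when they do not depend on it, the
  case \<open>k = 0\<close> implies the others.\<close>

locale change_point_model =
  fixes M :: "'w measure" and N :: "'s measure" and X :: "nat \<Rightarrow> 'w \<Rightarrow> 's"
    and Pinf :: "'w measure" and P :: "nat \<Rightarrow> 'w measure"
    and g :: "nat \<Rightarrow> (nat \<Rightarrow> 's) \<Rightarrow> 's \<Rightarrow> real"
    and f :: "nat \<Rightarrow> nat \<Rightarrow> (nat \<Rightarrow> 's) \<Rightarrow> 's \<Rightarrow> real"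
  assumes sigma_finite: "sigma_finite_measure N"
    and observations: "\<And>i. 1 \<le> i \<Longrightarrow> X i \<in> M \<rightarrow>\<^sub>M N"
    and prob_Pinf: "prob_space Pinf" "sets Pinf = sets M"
    and prob_P: "\<And>k. prob_space (P k)" "\<And>k. sets (P k) = sets M"
    and g_measurable: "\<And>i. 1 \<le> i \<Longrightarrow>
          (\<lambda>(h, x). g i h x) \<in> borel_measurable ((\<Pi>\<^sub>M j\<in>{1..i - 1}. N) \<Otimes>\<^sub>M N)"
    and f_measurable: "\<And>k i. k < i \<Longrightarrow>
          (\<lambda>(h, x). f k i h x) \<in> borel_measurable ((\<Pi>\<^sub>M j\<in>{1..i - 1}. N) \<Otimes>\<^sub>M N)"
    and g_nonneg: "\<And>i h x. 1 \<le> i \<Longrightarrow> h \<in> space (\<Pi>\<^sub>M j\<in>{1..i - 1}. N) \<Longrightarrow> x \<in> space N \<Longrightarrow>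
          0 \<le> g i h x"
    and f_nonneg: "\<And>k i h x. k < i \<Longrightarrow> h \<in> space (\<Pi>\<^sub>M j\<in>{1..i - 1}. N) \<Longrightarrow> x \<in> space N \<Longrightarrow>
          0 \<le> f k i h x"
    and density_Pinf: "\<And>n. 1 \<le> n \<Longrightarrow> distributed Pinf (\<Pi>\<^sub>M i\<in>{1..n}. N) (history X n)
          (\<lambda>x. ennreal (\<Prod>i\<in>{1..n}. g i (restrict x {1..i - 1}) (x i)))"
    and density_P: "\<And>k n. 1 \<le> n \<Longrightarrow> distributed (P k) (\<Pi>\<^sub>M i\<in>{1..n}. N) (history X n)
          (\<lambda>x. ennreal (joint_density g f k n x))"
    and mutually_ac: "\<And>k n. 1 \<le> n \<Longrightarrow>
          absolutely_continuous (restr_to_subalg Pinf (obs_algebra M N X n))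
                                (restr_to_subalg (P k) (obs_algebra M N X n))"
        "\<And>k n. 1 \<le> n \<Longrightarrow>
          absolutely_continuous (restr_to_subalg (P k) (obs_algebra M N X n))
                                (restr_to_subalg Pinf (obs_algebra M N X n))"

section \<open>Likelihood ratios\<close>

text \<open>By mutual absolute continuity \<open>likelihood_ratio g f X k i\<close> for \<open>i > k\<close> is a.s. a quotient of
  positive numbers, so the values of \<open>/\<close> and \<open>ln\<close> at \<open>0\<close> play no role.\<close>

definition likelihood_ratio ::
  "(nat \<Rightarrow> (nat \<Rightarrow> 's) \<Rightarrow> 's \<Rightarrow> real) \<Rightarrow> (nat \<Rightarrow> nat \<Rightarrow> (nat \<Rightarrow> 's) \<Rightarrow> 's \<Rightarrow> real)
    \<Rightarrow> (nat \<Rightarrow> 'w \<Rightarrow> 's) \<Rightarrow> nat \<Rightarrow> nat \<Rightarrow> 'w \<Rightarrow> real" where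
  "likelihood_ratio g f X k i \<omega> =
     f k i (history X (i - 1) \<omega>) (X i \<omega>) / g i (history X (i - 1) \<omega>) (X i \<omega>)"

definition log_likelihood_sum ::
  "(nat \<Rightarrow> (nat \<Rightarrow> 's) \<Rightarrow> 's \<Rightarrow> real) \<Rightarrow> (nat \<Rightarrow> nat \<Rightarrow> (nat \<Rightarrow> 's) \<Rightarrow> 's \<Rightarrow> real)
    \<Rightarrow> (nat \<Rightarrow> 'w \<Rightarrow> 's) \<Rightarrow> nat \<Rightarrow> nat \<Rightarrow> 'w \<Rightarrow> real" where
  "log_likelihood_sum g f X k n \<omega> = (\<Sum>i\<in>{k + 1..k + n}. ln (likelihood_ratio g f X k i \<omega>))"

section \<open>Prior distribution, detection procedures and their characteristics\<close>

definition prior_mass :: "int pmf \<Rightarrow> nat \<Rightarrow> real" where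
  "prior_mass \<nu> k = pmf \<nu> (int k)"

definition prior_cdf :: "int pmf \<Rightarrow> nat \<Rightarrow> real" where
  "prior_cdf \<nu> n = measure_pmf.prob \<nu> {..int n}"

definition prior_neg :: "int pmf \<Rightarrow> real" where
  "prior_neg \<nu> = measure_pmf.prob \<nu> {..<0}"

text \<open>The time \<open>\<infinity>\<close> carries the full \<open>\<sigma>\<close>-algebra, so that the condition at \<open>\<infinity>\<close> is void and the library
  notion of stopping time says \<open>{T \<le> n} \<in> \<F>\<^sub>n\<close> for all finite \<open>n\<close>.\<close>

definition detection_procedures ::
  "'w measure \<Rightarrow> 's measure \<Rightarrow> (nat \<Rightarrow> 'w \<Rightarrow> 's) \<Rightarrow> ('w \<Rightarrow> enat) set" where
  "detection_procedures M N X =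
     {T. stopping_time (case_enat (obs_algebra M N X) M) T \<and> (\<forall>\<omega>\<in>space M. 1 \<le> T \<omega>)}"

definition PFA :: "int pmf \<Rightarrow> 'w measure \<Rightarrow> ('w \<Rightarrow> enat) \<Rightarrow> ennreal" where
  "PFA \<nu> Pinf T =
     (\<Sum>j. ennreal (prior_mass \<nu> (Suc j)) * emeasure Pinf {\<omega> \<in> space Pinf. T \<omega> \<le> enat (Suc j)})"

definition PFA_class ::
  "'w measure \<Rightarrow> 's measure \<Rightarrow> (nat \<Rightarrow> 'w \<Rightarrow> 's) \<Rightarrow> int pmf \<Rightarrow> 'w measure \<Rightarrow> real
    \<Rightarrow> ('w \<Rightarrow> enat) set" where
  "PFA_class M N X \<nu> Pinf \<alpha> = {T \<in> detection_procedures M N X. PFA \<nu> Pinf T \<le> ennreal \<alpha>}"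

text \<open>\<open>delay_power m k t\<close> is \<open>((t - k)\<^sup>+)\<^sup>m\<close> for \<open>m > 0\<close>; the truncated subtraction on the natural numbers
  is the positive part.\<close>

definition delay_power :: "real \<Rightarrow> nat \<Rightarrow> enat \<Rightarrow> ennreal" where
  "delay_power m k t = (case t of enat n \<Rightarrow> ennreal (real (n - k) powr m) | \<infinity> \<Rightarrow> \<infinity>)"

definition delay_moment ::
  "int pmf \<Rightarrow> 'w measure \<Rightarrow> (nat \<Rightarrow> 'w measure) \<Rightarrow> real \<Rightarrow> ('w \<Rightarrow> enat) \<Rightarrow> ennreal" where
  "delay_moment \<nu> Pinf P m T =
     (\<Sum>k. ennreal (prior_mass \<nu> k) * (\<integral>\<^sup>+ \<omega>. delay_power m k (T \<omega>) \<partial>P k)) /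
     (\<Sum>k. ennreal (prior_mass \<nu> k) * emeasure Pinf {\<omega> \<in> space Pinf. enat k < T \<omega>})"

section \<open>The Shiryaev procedure\<close>

text \<open>A change before the observations start (\<open>\<nu> < 0\<close>) produces the same observations as \<open>\<nu> = 0\<close>; hence
  the first summand uses the likelihood ratios for change point \<open>0\<close>.\<close>

definition shiryaev_statistic ::
  "int pmf \<Rightarrow> (nat \<Rightarrow> (nat \<Rightarrow> 's) \<Rightarrow> 's \<Rightarrow> real) \<Rightarrow> (nat \<Rightarrow> nat \<Rightarrow> (nat \<Rightarrow> 's) \<Rightarrow> 's \<Rightarrow> real)
    \<Rightarrow> (nat \<Rightarrow> 'w \<Rightarrow> 's) \<Rightarrow> nat \<Rightarrow> 'w \<Rightarrow> real" where
  "shiryaev_statistic \<nu> g f X n \<omega> =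
     (prior_neg \<nu> * (\<Prod>i\<in>{1..n}. likelihood_ratio g f X 0 i \<omega>) +
      (\<Sum>k<n. prior_mass \<nu> k * (\<Prod>i\<in>{k + 1..n}. likelihood_ratio g f X k i \<omega>)))
     / measure_pmf.prob \<nu> {int n..}"

definition shiryaev_time ::
  "int pmf \<Rightarrow> (nat \<Rightarrow> (nat \<Rightarrow> 's) \<Rightarrow> 's \<Rightarrow> real) \<Rightarrow> (nat \<Rightarrow> nat \<Rightarrow> (nat \<Rightarrow> 's) \<Rightarrow> 's \<Rightarrow> real)
    \<Rightarrow> (nat \<Rightarrow> 'w \<Rightarrow> 's) \<Rightarrow> real \<Rightarrow> 'w \<Rightarrow> enat" where
  "shiryaev_time \<nu> g f X A \<omega> = Inf {enat n | n. 1 \<le> n \<and> A \<le> shiryaev_statistic \<nu> g f X n \<omega>}"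

section \<open>Asymptotic equivalence of extended nonnegative functions\<close>

text \<open>The asymptotic equivalence of the library needs values in a normed field, whereas moments of the
  delay may be infinite.\<close>

definition ratio_equiv :: "('a \<Rightarrow> ennreal) \<Rightarrow> ('a \<Rightarrow> ennreal) \<Rightarrow> 'a filter \<Rightarrow> bool" where
  "ratio_equiv u v F \<longleftrightarrow> ((\<lambda>x. u x / v x) \<longlongrightarrow> 1) F"

end

theory Submission
  imports Defs "HOL-Real_Asymp.Real_Asymp"
begin

text \<open>A change of measure reduces everything to the likelihood ratio process under \<open>P\<^sub>\<infinity>\<close>.

  Lower bound: before time \<open>k + L\<close> with \<open>L = (1 - \<delta>) |ln \<alpha>| / (I + \<mu>)\<close> the likelihood ratio exceeds
  \<open>exp ((I + \<epsilon>) L)\<close> only with vanishing probability under \<open>P\<^sub>k\<close>, and \<open>P\<^sub>\<infinity>(T \<le> n) \<le> \<alpha> / P(\<nu> \<ge> n)\<close> is about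
  \<open>\<alpha> exp (\<mu> n)\<close>. Hence \<open>P\<^sub>k(k < T \<le> k + L)\<close> tends to \<open>0\<close> uniformly over the class, for every fixed \<open>k\<close>,
  and Markov's inequality bounds the moments of the delay from below.

  Upper bound: \<open>\<Lambda>\<^sub>n\<close> dominates its single term of index \<open>k\<close>, so \<open>T\<^sub>A > k + n\<close> forces \<open>\<lambda>\<close> to deviate from \<open>n I\<close>
  once \<open>n\<close> is at least about \<open>(ln A + |ln \<pi>\<^sub>k|) / (I + \<mu>)\<close>; the contribution of these deviations to
  the moments is bounded by the complete convergence assumption.\<close>

section \<open>Change of measure\<close>

text \<open>Summation over the change points shapes both bounds. In the upper bound the estimate for
  one \<open>k\<close> carries |ln \<pi>_k|, which is unbounded in \<open>k\<close>. So ln A is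
  separated from it inside the power \<open>m\<close>, at the price of a factor arbitrarily close to
  1, and all that depends on \<open>k\<close> is summed into a constant. The logarithmic moment of
  the prior makes this sum finite; for \<mu> > 0 it follows from the exponential tail, so one
  argument serves both cases. In the lower bound the estimates are not uniform in \<open>k\<close>,
  and the prior is cut off at a finite index.

  The normalization P(T > \<nu>) equals 1 - q - PFA(T). In the lower bound it appears on both sides
  and only has to stay away from 0; in the upper bound it tends to 1 - q and cancels the total mass
  of the weights \<pi>_k.

  The inequality PFA(T_A) \<le> 1 / (1 + A) joins the two halves: with \<alpha> = 1 / (1 + A) the
  uniform lower bound applies to T_A itself, and with A = (1 - \<alpha>) / \<alpha> the infimum lies
  below the moment of T_A. Moments may be infinite, so differences are avoided and error terms are
  added on the larger side.\<close>

lemma restrict_history: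
  "m \<le> n \<Longrightarrow> restrict (history X n \<omega>) {1..m} = history X m \<omega>"
  by (auto simp: history_def restrict_def fun_eq_iff)

context change_point_model
begin

section \<open>Measurability with respect to the observed history\<close>

abbreviation obs_filtration :: "nat \<Rightarrow> 'w measure" where
  "obs_filtration \<equiv> obs_algebra M N X"

definition lr_prod :: "nat \<Rightarrow> nat \<Rightarrow> 'w \<Rightarrow> real" where
  "lr_prod k n \<omega> = (\<Prod>i\<in>{k + 1..n}. likelihood_ratio g f X k i \<omega>)"

lemma space_Pinf [simp]: "space Pinf = space M" and space_P [simp]: "space (P k) = space M"
  by (rule sets_eq_imp_space_eq[OF prob_Pinf(2)]) (rule sets_eq_imp_space_eq[OF prob_P(2)])

lemma history_measurable: "history X n \<in> M \<rightarrow>\<^sub>M (\<Pi>\<^sub>M i\<in>{1..n}. N)"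
  unfolding history_def by (rule measurable_restrict) (use observations in auto)

lemma space_obs_filtration [simp]: "space (obs_filtration n) = space M"
  by (simp add: obs_algebra_def)

lemma sets_obs_filtration:
  "sets (obs_filtration n) = {history X n -` B \<inter> space M | B. B \<in> sets (\<Pi>\<^sub>M i\<in>{1..n}. N)}"
  unfolding obs_algebra_def
  by (rule sets_vimage_algebra2) (use measurable_space[OF history_measurable] in auto)

lemma history_measurable_obs: "history X n \<in> obs_filtration n \<rightarrow>\<^sub>M (\<Pi>\<^sub>M i\<in>{1..n}. N)"
  unfolding obs_algebra_def
  by (rule measurable_vimage_algebra1) (use measurable_space[OF history_measurable] in auto)

lemma sets_obs_filtration_le: "sets (obs_filtration n) \<subseteq> sets M"
  using measurable_sets[OF history_measurable] by (auto simp: sets_obs_filtration)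

lemma sets_obs_filtration_P:
  "E \<in> sets (obs_filtration n) \<Longrightarrow> E \<in> sets M"
  "E \<in> sets (obs_filtration n) \<Longrightarrow> E \<in> sets (P k)"
  "E \<in> sets (obs_filtration n) \<Longrightarrow> E \<in> sets Pinf"
  using sets_obs_filtration_le prob_Pinf prob_P by auto

text \<open>The shorter history is a coordinate restriction of the longer one, hence a measurable
  function of it.\<close>

lemma obs_filtration_mono:
  assumes "m \<le> n" shows "sets (obs_filtration m) \<subseteq> sets (obs_filtration n)"
proof
  fix E assume "E \<in> sets (obs_filtration m)"
  then obtain B where B: "B \<in> sets (\<Pi>\<^sub>M i\<in>{1..m}. N)" "E = history X m -` B \<inter> space M"
    by (auto simp: sets_obs_filtration)
  have "(\<lambda>x. restrict x {1..m}) \<in> (\<Pi>\<^sub>M i\<in>{1..n}. N) \<rightarrow>\<^sub>M (\<Pi>\<^sub>M i\<in>{1..m}. N)"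
    by (rule measurable_restrict_subset) (use assms in auto)
  from measurable_comp[OF history_measurable_obs this]
  have "history X m \<in> obs_filtration n \<rightarrow>\<^sub>M (\<Pi>\<^sub>M i\<in>{1..m}. N)"
    unfolding comp_def restrict_history[OF assms] .
  from measurable_sets[OF this B(1)] show "E \<in> sets (obs_filtration n)"
    using B(2) by simp
qed

lemma measurable_obs_filtration_mono:
  "h \<in> obs_filtration m \<rightarrow>\<^sub>M K \<Longrightarrow> m \<le> n \<Longrightarrow> h \<in> obs_filtration n \<rightarrow>\<^sub>M K"
  using obs_filtration_mono[of m n] by (auto simp: measurable_def)

lemma measurable_obs_filtration_M:
  "h \<in> obs_filtration m \<rightarrow>\<^sub>M K \<Longrightarrow> h \<in> M \<rightarrow>\<^sub>M K"
  using sets_obs_filtration_le[of m] by (auto simp: measurable_def)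

lemma subalgebra_obs: "subalgebra Pinf (obs_filtration n)"
  "subalgebra (P k) (obs_filtration n)"
  using sets_obs_filtration_le prob_Pinf prob_P by (auto simp: subalgebra_def)

section \<open>Densities and likelihood ratios on path space\<close>

lemma path_density_measurable:
  fixes i n :: nat
  assumes "1 \<le> i" "i \<le> n"
    and h: "(\<lambda>(h, x). d i h x) \<in> borel_measurable ((\<Pi>\<^sub>M j\<in>{1..i - 1}. N) \<Otimes>\<^sub>M N)"
  shows "(\<lambda>x. d i (restrict x {1..i - 1}) (x i)) \<in> borel_measurable (\<Pi>\<^sub>M j\<in>{1..n}. N)"
proof -
  have "(\<lambda>x. (restrict x {1..i - 1}, x i)) \<in> (\<Pi>\<^sub>M j\<in>{1..n}. N) \<rightarrow>\<^sub>M (\<Pi>\<^sub>M j\<in>{1..i - 1}. N) \<Otimes>\<^sub>M N"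
    by (intro measurable_Pair measurable_restrict_subset measurable_component_singleton)
      (use assms(1,2) in auto)
  from measurable_comp[OF this h] show ?thesis by (simp add: comp_def)
qed

lemma g_path_measurable:
  "1 \<le> i \<Longrightarrow> i \<le> n \<Longrightarrow>
    (\<lambda>x. g i (restrict x {1..i - 1}) (x i)) \<in> borel_measurable (\<Pi>\<^sub>M j\<in>{1..n}. N)"
  by (rule path_density_measurable) (use g_measurable in auto)

lemma f_path_measurable:
  "k < i \<Longrightarrow> i \<le> n \<Longrightarrow>
    (\<lambda>x. f k i (restrict x {1..i - 1}) (x i)) \<in> borel_measurable (\<Pi>\<^sub>M j\<in>{1..n}. N)"
  by (rule path_density_measurable) (use f_measurable in auto)

lemma path_nonneg:
  assumes "x \<in> space (\<Pi>\<^sub>M j\<in>{1..n}. N)" "1 \<le> i" "i \<le> n"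
  shows "0 \<le> g i (restrict x {1..i - 1}) (x i)"
    and "k < i \<Longrightarrow> 0 \<le> f k i (restrict x {1..i - 1}) (x i)"
proof -
  have "restrict x {1..i - 1} \<in> space (\<Pi>\<^sub>M j\<in>{1..i - 1}. N)" "x i \<in> space N"
    using assms by (auto simp: space_PiM PiE_def Pi_def)
  then show "0 \<le> g i (restrict x {1..i - 1}) (x i)"
    and "k < i \<Longrightarrow> 0 \<le> f k i (restrict x {1..i - 1}) (x i)"
    using g_nonneg f_nonneg assms by auto
qed

text \<open>The joint densities live on path space, so the ratio is formed there and pulled back by
  \<open>lr_prod_history\<close>. Where \<open>g\<close> vanishes, division makes the factor 0,
  which keeps the product measurable and nonnegative.\<close>

definition path_lr :: "nat \<Rightarrow> nat \<Rightarrow> (nat \<Rightarrow> 's) \<Rightarrow> real" where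
  "path_lr k n x = (\<Prod>i\<in>{k + 1..n}.
     f k i (restrict x {1..i - 1}) (x i) / g i (restrict x {1..i - 1}) (x i))"

lemma path_lr_measurable: "path_lr k n \<in> borel_measurable (\<Pi>\<^sub>M j\<in>{1..n}. N)"
  unfolding path_lr_def[abs_def]
  by (intro borel_measurable_prod borel_measurable_divide g_path_measurable f_path_measurable) auto

lemma path_lr_nonneg: "x \<in> space (\<Pi>\<^sub>M j\<in>{1..n}. N) \<Longrightarrow> 0 \<le> path_lr k n x"
  unfolding path_lr_def using path_nonneg by (intro prod_nonneg divide_nonneg_nonneg ballI) auto

lemma likelihood_ratio_history:
  "1 \<le> i \<Longrightarrow> i \<le> n \<Longrightarrow> likelihood_ratio g f X k i \<omega> =
    f k i (restrict (history X n \<omega>) {1..i - 1}) (history X n \<omega> i) /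
    g i (restrict (history X n \<omega>) {1..i - 1}) (history X n \<omega> i)"
  using restrict_history[of "i - 1" n X \<omega>] unfolding likelihood_ratio_def
  by (auto simp: history_def)

lemma lr_prod_history: "lr_prod k n \<omega> = path_lr k n (history X n \<omega>)"
  unfolding lr_prod_def path_lr_def by (intro prod.cong likelihood_ratio_history) auto

lemma lr_prod_measurable: "lr_prod k n \<in> borel_measurable (obs_filtration n)"
  using measurable_comp[OF history_measurable_obs path_lr_measurable[of k n]]
  by (simp add: comp_def lr_prod_history[abs_def] lr_prod_history)

lemma likelihood_ratio_measurable:
  assumes "k < i"
  shows "likelihood_ratio g f X k i \<in> borel_measurable M"
proof -
  have "(\<lambda>x. f k i (restrict x {1..i - 1}) (x i) / g i (restrict x {1..i - 1}) (x i))
      \<in> borel_measurable (\<Pi>\<^sub>M j\<in>{1..i}. N)"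
    by (intro borel_measurable_divide g_path_measurable f_path_measurable) (use assms in auto)
  from measurable_comp[OF history_measurable this] show ?thesis
    using assms by (subst measurable_cong[OF likelihood_ratio_history]) (auto simp: comp_def)
qed

lemma likelihood_ratio_nonneg:
  assumes "\<omega> \<in> space M" "k < i"
  shows "0 \<le> likelihood_ratio g f X k i \<omega>"
  using likelihood_ratio_history[of i i k \<omega>] path_nonneg(1)[of "history X i \<omega>" i i]
    path_nonneg(2)[of "history X i \<omega>" i i k]
    measurable_space[OF history_measurable assms(1)] assms
  by auto

lemma lr_prod_nonneg: "\<omega> \<in> space M \<Longrightarrow> 0 \<le> lr_prod k n \<omega>"
  unfolding lr_prod_def using likelihood_ratio_nonneg by (intro prod_nonneg) auto

lemma log_likelihood_sum_measurable:
  "log_likelihood_sum g f X k n \<in> borel_measurable M"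
  unfolding log_likelihood_sum_def[abs_def]
  by (intro borel_measurable_sum borel_measurable_ln likelihood_ratio_measurable) auto

lemma emeasure_history:
  assumes "distributed Q (\<Pi>\<^sub>M i\<in>{1..n}. N) (history X n) d" "space Q = space M"
    "B \<in> sets (\<Pi>\<^sub>M i\<in>{1..n}. N)"
  shows "emeasure Q (history X n -` B \<inter> space M) =
    (\<integral>\<^sup>+x. d x * indicator B x \<partial>(\<Pi>\<^sub>M i\<in>{1..n}. N))"
  using distributed_emeasure[OF assms(1,3)] assms(2) by simp

text \<open>Off the zero set \<open>Z\<close> of the pre-change density this is cancellation of
  factors. On \<open>Z\<close> the right side is 0, and absolute continuity makes the left side
  vanish too: the event that the history lies in \<open>Z\<close> is null for \<open>Pinf\<close>,
  hence for \<open>P k\<close>, so the density under \<open>P k\<close> is 0 almost everywhere on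
  \<open>Z\<close>.\<close>

lemma joint_density_eq_path_lr:
  assumes "1 \<le> n" "k \<le> n"
  shows "AE x in (\<Pi>\<^sub>M i\<in>{1..n}. N). ennreal (joint_density g f k n x) =
    ennreal (\<Prod>i\<in>{1..n}. g i (restrict x {1..i - 1}) (x i)) * ennreal (path_lr k n x)"
proof -
  let ?S = "\<Pi>\<^sub>M i\<in>{1..n}. N" and ?J = "joint_density g f k n"
  let ?G = "\<lambda>x. \<Prod>i\<in>{1..n}. g i (restrict x {1..i - 1}) (x i)"
  have G: "?G \<in> borel_measurable ?S"
    by (intro borel_measurable_prod g_path_measurable) auto
  define Z where "Z = {x \<in> space ?S. ?G x = 0}"
  have Z: "Z \<in> sets ?S" unfolding Z_def using G by measurable
  let ?E = "history X n -` Z \<inter> space M"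
  have E: "?E \<in> sets (obs_filtration n)" using Z by (auto simp: sets_obs_filtration)
  have "emeasure Pinf ?E = (\<integral>\<^sup>+x. ennreal (?G x) * indicator Z x \<partial>?S)"
    by (rule emeasure_history[OF density_Pinf[OF assms(1)] _ Z]) simp
  also have "\<dots> = (\<integral>\<^sup>+x. 0 \<partial>?S)"
    by (intro nn_integral_cong) (auto simp: Z_def indicator_def simp del: prod_zero_iff)
  finally have "?E \<in> null_sets Pinf"
    using sets_obs_filtration_P[OF E] by (simp add: null_setsI)
  then have "?E \<in> null_sets (restr_to_subalg Pinf (obs_filtration n))"
    using null_sets_restr_to_subalg[OF subalgebra_obs(1)] E by auto
  then have "?E \<in> null_sets (restr_to_subalg (P k) (obs_filtration n))"
    using mutually_ac(1)[OF assms(1), of k] by (auto simp: absolutely_continuous_def)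
  then have "emeasure (P k) ?E = 0"
    using null_sets_restr_to_subalg[OF subalgebra_obs(2)] by auto
  then have "(\<integral>\<^sup>+x. ennreal (?J x) * indicator Z x \<partial>?S) = 0"
    using emeasure_history[OF density_P[OF assms(1)] _ Z] by simp
  then have "AE x in ?S. ennreal (?J x) * indicator Z x = 0"
    using Z distributed_borel_measurable[OF density_P[OF assms(1), of k]]
    by (subst (asm) nn_integral_0_iff_AE) auto
  then show ?thesis
  proof (rule AE_mp, intro AE_I2 impI)
    fix x assume x: "x \<in> space ?S" and *: "ennreal (?J x) * indicator Z x = 0"
    show "ennreal (?J x) = ennreal (?G x) * ennreal (path_lr k n x)"
    proof (cases "?G x = 0")
      case True
      then show ?thesis using * x by (auto simp: Z_def simp del: prod_zero_iff)
    next
      case False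
      have U: "{1..n} = {1..k} \<union> {k + 1..n}" using assms by auto
      have nz: "g i (restrict x {1..i - 1}) (x i) \<noteq> 0" if "i \<in> {1..n}" for i
        using False that by auto
      have "?G x * path_lr k n x = ?J x"
        unfolding U joint_density_def path_lr_def
        using nz assms by (subst prod.union_disjoint) (auto simp: prod_dividef min_def)
      moreover have "0 \<le> ?G x" using x path_nonneg by (intro prod_nonneg) auto
      ultimately show ?thesis
        using path_lr_nonneg[OF x] by (metis ennreal_mult)
    qed
  qed
qed

text \<open>The factorization of the joint density is integrated over the path set defining
  \<open>E\<close> and read as an integral under the \<open>Pinf\<close>-law of the history. It is
  stated at finite horizons because on the full \<sigma>-algebra the two measures may be mutually
  singular.\<close>

lemma change_of_measure:
  assumes "1 \<le> n" "k \<le> n" "E \<in> sets (obs_filtration n)"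
  shows "emeasure (P k) E = (\<integral>\<^sup>+\<omega>. ennreal (lr_prod k n \<omega>) * indicator E \<omega> \<partial>Pinf)"
proof -
  let ?S = "\<Pi>\<^sub>M i\<in>{1..n}. N"
  let ?G = "\<lambda>x. \<Prod>i\<in>{1..n}. g i (restrict x {1..i - 1}) (x i)"
  obtain B where B: "B \<in> sets ?S" "E = history X n -` B \<inter> space M"
    using assms by (auto simp: sets_obs_filtration)
  have m: "(\<lambda>x. ennreal (path_lr k n x) * indicator B x) \<in> borel_measurable ?S"
    using path_lr_measurable[of k n] B(1) by measurable
  have "emeasure (P k) E = (\<integral>\<^sup>+x. ennreal (joint_density g f k n x) * indicator B x \<partial>?S)"
    unfolding B(2) by (rule emeasure_history[OF density_P[OF assms(1)] _ B(1)]) simp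
  also have "\<dots> = (\<integral>\<^sup>+x. ennreal (?G x) * (ennreal (path_lr k n x) * indicator B x) \<partial>?S)"
    by (rule nn_integral_cong_AE)
      (use joint_density_eq_path_lr[OF assms(1,2)] in eventually_elim, auto simp: mult.assoc)
  also have "\<dots> = (\<integral>\<^sup>+\<omega>. ennreal (path_lr k n (history X n \<omega>)) * indicator B (history X n \<omega>) \<partial>Pinf)"
    by (rule distributed_nn_integral[OF density_Pinf[OF assms(1)] m])
  also have "\<dots> = (\<integral>\<^sup>+\<omega>. ennreal (lr_prod k n \<omega>) * indicator E \<omega> \<partial>Pinf)"
    by (intro nn_integral_cong) (auto simp: lr_prod_history B(2) indicator_def)
  finally show ?thesis .
qed

text \<open>At horizon \<open>k\<close> the product of likelihood ratios is empty, and an event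
  known at time \<open>n\<close> \<le> \<open>k\<close> is also known at time
  \<open>k\<close>.\<close>

lemma emeasure_P_pre_change:
  assumes "1 \<le> n" "n \<le> k" "E \<in> sets (obs_filtration n)"
  shows "emeasure (P k) E = emeasure Pinf E"
proof -
  have "emeasure (P k) E = (\<integral>\<^sup>+\<omega>. ennreal (lr_prod k k \<omega>) * indicator E \<omega> \<partial>Pinf)"
    by (rule change_of_measure) (use assms obs_filtration_mono[of n k] in auto)
  also have "\<dots> = emeasure Pinf E"
    using sets_obs_filtration_P[OF assms(3)] by (simp add: lr_prod_def)
  finally show ?thesis .
qed

text \<open>The mass that \<open>P k\<close> gives to the zero set of \<open>lr_prod k n\<close> is
  the \<open>Pinf\<close>-integral of \<open>lr_prod k n\<close> over that very set.\<close>

lemma AE_lr_prod_pos: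
  assumes "1 \<le> n" "k \<le> n"
  shows "AE \<omega> in P k. 0 < lr_prod k n \<omega>"
proof -
  let ?E = "{\<omega> \<in> space M. lr_prod k n \<omega> = 0}"
  have E: "?E \<in> sets (obs_filtration n)"
    using borel_measurable_eq[OF lr_prod_measurable borel_measurable_const, of n k 0] by simp
  have "emeasure (P k) ?E = (\<integral>\<^sup>+\<omega>. 0 \<partial>Pinf)"
    unfolding change_of_measure[OF assms E] by (intro nn_integral_cong) (auto simp: indicator_def)
  then have "?E \<in> null_sets (P k)" using sets_obs_filtration_P[OF E] by (simp add: null_setsI)
  then show ?thesis
    by (rule AE_I') (use lr_prod_nonneg order_less_le in fastforce)
qed

text \<open>Equality can fail only if some factor vanishes, where \<open>ln 0 = 0\<close>; then the
  left side is 0 and the inequality survives. The unconditional half serves the lower bound on the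
  delay, the conditional half the upper bound.\<close>

lemma lr_prod_le_exp:
  assumes "\<omega> \<in> space M"
  shows "lr_prod k (k + n) \<omega> \<le> exp (log_likelihood_sum g f X k n \<omega>)"
    and "0 < lr_prod k (k + n) \<omega> \<Longrightarrow>
      lr_prod k (k + n) \<omega> = exp (log_likelihood_sum g f X k n \<omega>)"
proof -
  have nn: "0 \<le> likelihood_ratio g f X k i \<omega>" if "i \<in> {k + 1..k + n}" for i
    using likelihood_ratio_nonneg[OF assms] that by auto
  have *: "lr_prod k (k + n) \<omega> = exp (log_likelihood_sum g f X k n \<omega>)"
    if "0 < lr_prod k (k + n) \<omega>"
  proof -
    have "0 < likelihood_ratio g f X k i \<omega>" if "i \<in> {k + 1..k + n}" for i
      using nn[OF that] \<open>0 < lr_prod k (k + n) \<omega>\<close> that unfolding lr_prod_def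
      by (metis finite_atLeastAtMost order_less_le prod_zero_iff)
    then show ?thesis by (simp add: lr_prod_def log_likelihood_sum_def exp_sum)
  qed
  then show "0 < lr_prod k (k + n) \<omega> \<Longrightarrow>
      lr_prod k (k + n) \<omega> = exp (log_likelihood_sum g f X k n \<omega>)" .
  show "lr_prod k (k + n) \<omega> \<le> exp (log_likelihood_sum g f X k n \<omega>)"
    using * by (cases "0 < lr_prod k (k + n) \<omega>") (auto intro: order_trans[of _ 0])
qed

end

section \<open>The prior distribution and the probability of false alarm\<close>

lemma ennreal_suminf_swap:
  fixes u :: "nat \<Rightarrow> nat \<Rightarrow> ennreal"
  shows "(\<Sum>i. \<Sum>j. u i j) = (\<Sum>j. \<Sum>i. u i j)"
  using nn_integral_suminf[of "\<lambda>j i. u i j" "count_space UNIV"]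
  by (simp add: nn_integral_count_space_nat)

lemma ennreal_suminf_offset_le:
  fixes u :: "nat \<Rightarrow> ennreal"
  shows "(\<Sum>j. u (n + j)) \<le> (\<Sum>j. u j)"
  using suminf_offset[of u n] by (simp add: add.commute)

lemma prior_mass_nonneg [simp]: "0 \<le> prior_mass \<nu> k"
  by (simp add: prior_mass_def)

lemma prior_mass_le_1: "prior_mass \<nu> k \<le> 1"
  by (simp add: prior_mass_def pmf_le_1)

lemma prior_mass_tail_sums:
  "(\<lambda>j. prior_mass \<nu> (n + j)) sums measure_pmf.prob \<nu> {int n..}"
proof -
  have "{int n..} = (\<Union>j. {int (n + j)})"
  proof -
    have "\<exists>j. x = int (n + j)" if "int n \<le> x" for x
      using that by (intro exI[of _ "nat x - n"]) auto
    then show ?thesis by force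
  qed
  moreover have "disjoint_family (\<lambda>j. {int (n + j)})"
    by (auto simp: disjoint_family_on_def)
  ultimately show ?thesis
    using measure_pmf.finite_measure_UNION[of "\<lambda>j. {int (n + j)}" \<nu>]
    by (simp add: prior_mass_def measure_pmf_single)
qed

lemma suminf_prior_mass_tail:
  "(\<Sum>j. ennreal (prior_mass \<nu> (n + j))) = ennreal (measure_pmf.prob \<nu> {int n..})"
  using prior_mass_tail_sums by (intro suminf_ennreal_eq) auto

lemma prob_atLeast_0: "measure_pmf.prob \<nu> {int 0..} = 1 - prior_neg \<nu>"
proof -
  have "{int 0..} = UNIV - {..<0}" by auto
  then show ?thesis using measure_pmf.prob_compl[of "{..<0}" \<nu>] by (simp add: prior_neg_def)
qed

lemma prob_atLeast_Suc: "measure_pmf.prob \<nu> {int (Suc n)..} = 1 - prior_cdf \<nu> n"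
proof -
  have "{int (Suc n)..} = UNIV - {..int n}" by auto
  then show ?thesis using measure_pmf.prob_compl[of "{..int n}" \<nu>] by (simp add: prior_cdf_def)
qed

lemma suminf_prior_mass: "(\<Sum>k. ennreal (prior_mass \<nu> k)) = ennreal (1 - prior_neg \<nu>)"
  using suminf_prior_mass_tail[of \<nu> 0] by (simp only: prob_atLeast_0 add_0)

lemma prior_mass_summable: "summable (prior_mass \<nu>)"
  using prior_mass_tail_sums[of \<nu> 0] by (simp add: sums_iff)

lemma prior_neg_nonneg [simp]: "0 \<le> prior_neg \<nu>" and prior_neg_le_1 [simp]: "prior_neg \<nu> \<le> 1"
  by (simp_all add: prior_neg_def)

text \<open>A nonempty set in \<open>enat\<close> attains its infimum, and the infimum of the empty
  set is infinity, so a finite value is always a genuine crossing time.\<close>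

lemma shiryaev_time_le_iff:
  "shiryaev_time \<nu> g f X A \<omega> \<le> enat n \<longleftrightarrow>
    (\<exists>j\<in>{1..n}. A \<le> shiryaev_statistic \<nu> g f X j \<omega>)"
proof
  let ?S = "{enat n | n. 1 \<le> n \<and> A \<le> shiryaev_statistic \<nu> g f X n \<omega>}"
  assume *: "shiryaev_time \<nu> g f X A \<omega> \<le> enat n"
  have "?S \<noteq> {}"
  proof
    assume "?S = {}"
    then have "shiryaev_time \<nu> g f X A \<omega> = Inf {}" unfolding shiryaev_time_def by (rule arg_cong)
    with * show False by (simp add: Inf_enat_def)
  qed
  then obtain x where "x \<in> ?S" by blast
  then have "(LEAST x. x \<in> ?S) \<in> ?S" by (rule LeastI)
  then have "Inf ?S \<in> ?S" unfolding Inf_enat_def if_not_P[OF \<open>?S \<noteq> {}\<close>] .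
  then obtain j where "Inf ?S = enat j" "1 \<le> j" "A \<le> shiryaev_statistic \<nu> g f X j \<omega>" by blast
  with * show "\<exists>j\<in>{1..n}. A \<le> shiryaev_statistic \<nu> g f X j \<omega>"
    unfolding shiryaev_time_def by (intro bexI[of _ j]) auto
next
  assume "\<exists>j\<in>{1..n}. A \<le> shiryaev_statistic \<nu> g f X j \<omega>"
  then obtain j where "1 \<le> j" "j \<le> n" "A \<le> shiryaev_statistic \<nu> g f X j \<omega>" by auto
  then have "shiryaev_time \<nu> g f X A \<omega> \<le> enat j"
    unfolding shiryaev_time_def by (intro Inf_lower) auto
  also have "enat j \<le> enat n" using \<open>j \<le> n\<close> by simp
  finally show "shiryaev_time \<nu> g f X A \<omega> \<le> enat n" .
qed

lemma shiryaev_time_eq_imp: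
  assumes "shiryaev_time \<nu> g f X A \<omega> = enat n"
  shows "1 \<le> n" "A \<le> shiryaev_statistic \<nu> g f X n \<omega>"
proof -
  obtain j where j: "j \<in> {1..n}" "A \<le> shiryaev_statistic \<nu> g f X j \<omega>"
    using shiryaev_time_le_iff[of \<nu> g f X A \<omega> n] assms by auto
  then have "shiryaev_time \<nu> g f X A \<omega> \<le> enat j"
    unfolding shiryaev_time_le_iff by (intro bexI[of _ j]) auto
  with assms j show "1 \<le> n" "A \<le> shiryaev_statistic \<nu> g f X n \<omega>" by auto
qed

context change_point_model
begin

lemma shiryaev_statistic_lr_prod:
  "shiryaev_statistic \<nu> g f X n \<omega> = (prior_neg \<nu> * lr_prod 0 n \<omega> +
     (\<Sum>k<n. prior_mass \<nu> k * lr_prod k n \<omega>)) / measure_pmf.prob \<nu> {int n..}"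
  by (simp add: shiryaev_statistic_def lr_prod_def)

lemma shiryaev_statistic_measurable:
  "shiryaev_statistic \<nu> g f X n \<in> borel_measurable (obs_filtration n)"
  unfolding shiryaev_statistic_lr_prod[abs_def]
  by (intro borel_measurable_divide borel_measurable_add borel_measurable_times
      borel_measurable_sum lr_prod_measurable) auto

lemma detection_procedure_le:
  assumes "T \<in> detection_procedures M N X"
  shows "{\<omega> \<in> space M. T \<omega> \<le> enat n} \<in> sets (obs_filtration n)"
proof -
  have "Measurable.pred (case_enat obs_filtration M (enat n)) (\<lambda>\<omega>. T \<omega> \<le> enat n)"
    using assms unfolding detection_procedures_def stopping_time_def by blast
  then show ?thesis by (simp add: pred_def)
qed

lemma detection_procedure_eq:
  assumes "T \<in> detection_procedures M N X"
  shows "{\<omega> \<in> space M. T \<omega> = enat n} \<in> sets (obs_filtration n)"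
proof -
  have "{\<omega> \<in> space M. T \<omega> = enat n} =
      {\<omega> \<in> space M. T \<omega> \<le> enat n} - (\<Union>j<n. {\<omega> \<in> space M. T \<omega> \<le> enat j})"
  proof (intro set_eqI)
    fix \<omega>
    show "\<omega> \<in> {\<omega> \<in> space M. T \<omega> = enat n} \<longleftrightarrow>
        \<omega> \<in> {\<omega> \<in> space M. T \<omega> \<le> enat n} - (\<Union>j<n. {\<omega> \<in> space M. T \<omega> \<le> enat j})"
      by (cases "T \<omega>") (auto simp: le_less)
  qed
  also have "\<dots> \<in> sets (obs_filtration n)"
    using detection_procedure_le[OF assms]
    by (intro sets.Diff sets.finite_UN) (auto intro: subsetD[OF obs_filtration_mono[OF less_imp_le]])
  finally show ?thesis .
qed

lemma detection_procedure_ge_1: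
  "T \<in> detection_procedures M N X \<Longrightarrow> \<omega> \<in> space M \<Longrightarrow> 1 \<le> T \<omega>"
  by (auto simp: detection_procedures_def)

lemma shiryaev_time_detection_procedure:
  "shiryaev_time \<nu> g f X A \<in> detection_procedures M N X"
proof -
  have "Measurable.pred (case_enat obs_filtration M t) (\<lambda>\<omega>. shiryaev_time \<nu> g f X A \<omega> \<le> t)" for t
  proof (cases t)
    case (enat n)
    have "{\<omega> \<in> space M. A \<le> shiryaev_statistic \<nu> g f X j \<omega>} \<in> sets (obs_filtration n)"
      if "j \<le> n" for j
      using borel_measurable_le[OF borel_measurable_const
          measurable_obs_filtration_mono[OF shiryaev_statistic_measurable that]] by simp
    then have "(\<Union>j\<in>{1..n}. {\<omega> \<in> space M. A \<le> shiryaev_statistic \<nu> g f X j \<omega>})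
        \<in> sets (obs_filtration n)"
      by (intro sets.finite_UN) auto
    also have "(\<Union>j\<in>{1..n}. {\<omega> \<in> space M. A \<le> shiryaev_statistic \<nu> g f X j \<omega>}) =
        {\<omega> \<in> space M. shiryaev_time \<nu> g f X A \<omega> \<le> enat n}"
      unfolding shiryaev_time_le_iff by auto
    finally show ?thesis using enat by (simp add: pred_def)
  qed simp
  moreover have "1 \<le> shiryaev_time \<nu> g f X A \<omega>" for \<omega>
    unfolding shiryaev_time_def by (intro Inf_greatest) (auto simp: one_enat_def)
  ultimately show ?thesis
    by (auto simp: detection_procedures_def stopping_time_def)
qed

lemma emeasure_T_gt:
  assumes T: "T \<in> detection_procedures M N X" and Q: "prob_space Q" "sets Q = sets M"
  shows "emeasure Q {\<omega> \<in> space M. enat k < T \<omega>} + emeasure Q {\<omega> \<in> space M. T \<omega> \<le> enat k} = 1"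
proof -
  have le: "{\<omega> \<in> space M. T \<omega> \<le> enat k} \<in> sets Q"
    using sets_obs_filtration_P(1)[OF detection_procedure_le[OF T]] Q by simp
  have eq: "{\<omega> \<in> space M. enat k < T \<omega>} = space Q - {\<omega> \<in> space M. T \<omega> \<le> enat k}"
    using sets_eq_imp_space_eq[OF Q(2)] by auto
  have "{\<omega> \<in> space M. enat k < T \<omega>} \<in> sets Q" unfolding eq using le by auto
  then have "emeasure Q {\<omega> \<in> space M. enat k < T \<omega>} + emeasure Q {\<omega> \<in> space M. T \<omega> \<le> enat k}
      = emeasure Q ({\<omega> \<in> space M. enat k < T \<omega>} \<union> {\<omega> \<in> space M. T \<omega> \<le> enat k})"
    using le by (intro plus_emeasure) (auto simp: not_le)
  also have "{\<omega> \<in> space M. enat k < T \<omega>} \<union> {\<omega> \<in> space M. T \<omega> \<le> enat k} = space Q"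
    using sets_eq_imp_space_eq[OF Q(2)] by auto
  finally show ?thesis using prob_space.emeasure_space_1[OF Q(1)] by simp
qed

lemma emeasure_T_le_0:
  assumes "T \<in> detection_procedures M N X"
  shows "{\<omega> \<in> space M. T \<omega> \<le> enat 0} = {}"
  using detection_procedure_ge_1[OF assms] by (fastforce simp flip: zero_enat_def)

text \<open>A procedure never stops at time 0, so the summand \<open>k = 0\<close> can be added and
  the sum matches the full prior on the nonnegative integers.\<close>

lemma PFA_eq_suminf:
  assumes "T \<in> detection_procedures M N X"
  shows "PFA \<nu> Pinf T =
    (\<Sum>k. ennreal (prior_mass \<nu> k) * emeasure Pinf {\<omega> \<in> space M. T \<omega> \<le> enat k})"
  using suminf_offset[of "\<lambda>k. ennreal (prior_mass \<nu> k) * emeasure Pinf {\<omega> \<in> space M. T \<omega> \<le> enat k}" 1]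
    emeasure_T_le_0[OF assms]
  by (simp add: PFA_def)

text \<open>This identifies the denominator of \<open>delay_moment\<close> as 1 - q - PFA(T); both
  bounds control it through the false alarm constraint.\<close>

lemma PFA_compl:
  assumes T: "T \<in> detection_procedures M N X"
  shows "(\<Sum>k. ennreal (prior_mass \<nu> k) * emeasure Pinf {\<omega> \<in> space M. enat k < T \<omega>})
    + PFA \<nu> Pinf T = ennreal (1 - prior_neg \<nu>)"
  unfolding PFA_eq_suminf[OF T]
  by (subst suminf_add) (auto simp flip: distrib_left
      simp: emeasure_T_gt[OF T prob_Pinf] suminf_prior_mass)

text \<open>Only the summands with index at least \<open>n\<close> are kept, and for these the event
  T \<le> \<open>n\<close> is contained in the event being weighted. The false alarm constraint
  enters the lower bound on early stopping through this inequality.\<close>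

lemma PFA_ge:
  assumes T: "T \<in> detection_procedures M N X"
  shows "ennreal (measure_pmf.prob \<nu> {int n..}) * emeasure Pinf {\<omega> \<in> space M. T \<omega> \<le> enat n}
    \<le> PFA \<nu> Pinf T"
proof -
  let ?u = "\<lambda>k. ennreal (prior_mass \<nu> k) * emeasure Pinf {\<omega> \<in> space M. T \<omega> \<le> enat k}"
  have "ennreal (measure_pmf.prob \<nu> {int n..}) * emeasure Pinf {\<omega> \<in> space M. T \<omega> \<le> enat n} =
      (\<Sum>j. ennreal (prior_mass \<nu> (n + j)) * emeasure Pinf {\<omega> \<in> space M. T \<omega> \<le> enat n})"
    by (simp add: suminf_prior_mass_tail)
  also have "\<dots> \<le> (\<Sum>j. ?u (n + j))"
  proof (intro suminf_le mult_left_mono emeasure_mono)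
    fix j
    show "{\<omega> \<in> space M. T \<omega> \<le> enat n} \<subseteq> {\<omega> \<in> space M. T \<omega> \<le> enat (n + j)}"
      by (auto intro: order_trans)
    show "{\<omega> \<in> space M. T \<omega> \<le> enat (n + j)} \<in> sets Pinf"
      by (rule sets_obs_filtration_P(3)[OF detection_procedure_le[OF T]])
  qed auto
  also have "\<dots> \<le> (\<Sum>k. ?u k)" by (rule ennreal_suminf_offset_le)
  finally show ?thesis unfolding PFA_eq_suminf[OF T] .
qed

text \<open>Interchange of summation: an alarm at time \<open>n\<close> is false for every change
  point \<open>k\<close> \<ge> \<open>n\<close>, and these carry total mass P(\<nu> \<ge> n). In
  this form the alarm times can be treated one at a time.\<close>

lemma PFA_eq_suminf_stop:
  assumes T: "T \<in> detection_procedures M N X"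
  shows "PFA \<nu> Pinf T = (\<Sum>n. ennreal (measure_pmf.prob \<nu> {int n..}) *
    emeasure Pinf {\<omega> \<in> space M. T \<omega> = enat n})"
proof -
  let ?e = "\<lambda>n. emeasure Pinf {\<omega> \<in> space M. T \<omega> = enat n}"
  have le: "emeasure Pinf {\<omega> \<in> space M. T \<omega> \<le> enat k} = (\<Sum>n. if n \<le> k then ?e n else 0)" for k
  proof -
    have "{\<omega> \<in> space M. T \<omega> \<le> enat k} = (\<Union>n\<le>k. {\<omega> \<in> space M. T \<omega> = enat n})"
    proof (intro set_eqI)
      fix \<omega>
      show "\<omega> \<in> {\<omega> \<in> space M. T \<omega> \<le> enat k} \<longleftrightarrow> \<omega> \<in> (\<Union>n\<le>k. {\<omega> \<in> space M. T \<omega> = enat n})"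
        by (cases "T \<omega>") auto
    qed
    also have "emeasure Pinf \<dots> = (\<Sum>n\<le>k. ?e n)"
      by (intro sum_emeasure[symmetric])
        (use sets_obs_filtration_P(3)[OF detection_procedure_eq[OF T]] in
          \<open>auto simp: disjoint_family_on_def\<close>)
    also have "\<dots> = (\<Sum>n. if n \<le> k then ?e n else 0)"
      by (subst suminf_finite[of "{..k}"]) (auto intro: sum.cong)
    finally show ?thesis .
  qed
  have "PFA \<nu> Pinf T =
      (\<Sum>k. \<Sum>n. ennreal (prior_mass \<nu> k) * (if n \<le> k then ?e n else 0))"
    unfolding PFA_eq_suminf[OF T] le by simp
  also have "\<dots> = (\<Sum>n. \<Sum>k. ennreal (prior_mass \<nu> k) * (if n \<le> k then ?e n else 0))"
    by (rule ennreal_suminf_swap)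
  also have "\<dots> = (\<Sum>n. ennreal (measure_pmf.prob \<nu> {int n..}) * ?e n)"
  proof (intro suminf_cong)
    fix n
    let ?u = "\<lambda>k. ennreal (prior_mass \<nu> k) * (if n \<le> k then ?e n else 0)"
    have "(\<Sum>k. ?u k) = (\<Sum>k. ?u (k + n)) + (\<Sum>k<n. ?u k)"
      by (rule suminf_offset) simp
    also have "(\<Sum>k<n. ?u k) = 0" by (intro sum.neutral) auto
    finally show "(\<Sum>k. ?u k) = ennreal (measure_pmf.prob \<nu> {int n..}) * ?e n"
      by (simp add: add.commute[of _ n] suminf_prior_mass_tail)
  qed
  finally show ?thesis .
qed

text \<open>Under the joint law of observations and change point, \<open>1 / (1 + \<Lambda>\<^sub>n)\<close> is the posterior
  probability of \<open>\<nu> \<ge> n\<close>; on \<open>T\<^sub>A = n\<close> it is at most \<open>1 / (1 + A)\<close>.\<close>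

lemma posterior_bound:
  assumes E: "E \<in> sets (obs_filtration n)" and n: "1 \<le> n" and A: "0 \<le> A"
    and c: "0 < measure_pmf.prob \<nu> {int n..}"
    and stat: "\<And>\<omega>. \<omega> \<in> E \<Longrightarrow> A \<le> shiryaev_statistic \<nu> g f X n \<omega>"
  shows "ennreal ((1 + A) * measure_pmf.prob \<nu> {int n..}) * emeasure Pinf E \<le>
    ennreal (prior_neg \<nu>) * emeasure (P 0) E + (\<Sum>k. ennreal (prior_mass \<nu> k) * emeasure (P k) E)"
proof -
  let ?c = "measure_pmf.prob \<nu> {int n..}"
  let ?S = "\<lambda>\<omega>. prior_neg \<nu> * lr_prod 0 n \<omega> + (\<Sum>k<n. prior_mass \<nu> k * lr_prod k n \<omega>)"
  have [measurable]: "E \<in> sets Pinf" using sets_obs_filtration_P[OF E] by simp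
  have [measurable]: "lr_prod k n \<in> borel_measurable Pinf" for k
    using measurable_obs_filtration_M[OF lr_prod_measurable] prob_Pinf(2)
    by (simp cong: measurable_cong_sets)
  have "ennreal (A * ?c) * emeasure Pinf E = (\<integral>\<^sup>+\<omega>. ennreal (A * ?c) * indicator E \<omega> \<partial>Pinf)"
    by (rule nn_integral_cmult_indicator[symmetric]) simp
  also have "\<dots> \<le> (\<integral>\<^sup>+\<omega>. ennreal (prior_neg \<nu>) * (ennreal (lr_prod 0 n \<omega>) * indicator E \<omega>) +
      (\<Sum>k<n. ennreal (prior_mass \<nu> k) * (ennreal (lr_prod k n \<omega>) * indicator E \<omega>)) \<partial>Pinf)"
  proof (rule nn_integral_mono)
    fix \<omega> assume "\<omega> \<in> space Pinf"
    then have \<omega>: "\<omega> \<in> space M" by simp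
    show "ennreal (A * ?c) * indicator E \<omega> \<le>
      ennreal (prior_neg \<nu>) * (ennreal (lr_prod 0 n \<omega>) * indicator E \<omega>) +
      (\<Sum>k<n. ennreal (prior_mass \<nu> k) * (ennreal (lr_prod k n \<omega>) * indicator E \<omega>))"
    proof (cases "\<omega> \<in> E")
      case True
      have "A * ?c \<le> ?S \<omega>"
        using stat[OF True] c by (simp add: shiryaev_statistic_lr_prod field_simps)
      then have "ennreal (A * ?c) \<le> ennreal (?S \<omega>)" by (rule ennreal_leI)
      then show ?thesis
        using True lr_prod_nonneg[OF \<omega>]
        by (simp add: sum_nonneg flip: ennreal_mult sum_ennreal)
    qed simp
  qed
  also have "\<dots> = ennreal (prior_neg \<nu>) * emeasure (P 0) E +
      (\<Sum>k<n. ennreal (prior_mass \<nu> k) * emeasure (P k) E)"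
  proof -
    have "(\<integral>\<^sup>+\<omega>. ennreal (lr_prod k n \<omega>) * indicator E \<omega> \<partial>Pinf) = emeasure (P k) E" if "k \<le> n" for k
      using change_of_measure[OF n that E] by simp
    then show ?thesis
      by (subst nn_integral_add) (auto simp: nn_integral_sum nn_integral_cmult)
  qed
  finally have 1: "ennreal (A * ?c) * emeasure Pinf E \<le> ennreal (prior_neg \<nu>) * emeasure (P 0) E +
      (\<Sum>k<n. ennreal (prior_mass \<nu> k) * emeasure (P k) E)" .
  \<comment> \<open>Change points \<open>k\<close> \<ge> \<open>n\<close> have not acted by time
    \<open>n\<close>, so they contribute \<open>?c\<close> times the \<open>Pinf\<close>-probability
    of \<open>E\<close>. This is the origin of the 1 in \<open>1 + A\<close>.\<close>
  have "(\<Sum>k. ennreal (prior_mass \<nu> k) * emeasure (P k) E) =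
      (\<Sum>k. ennreal (prior_mass \<nu> (k + n)) * emeasure (P (k + n)) E) +
      (\<Sum>k<n. ennreal (prior_mass \<nu> k) * emeasure (P k) E)"
    by (rule suminf_offset) simp
  also have "(\<Sum>k. ennreal (prior_mass \<nu> (k + n)) * emeasure (P (k + n)) E) = ennreal ?c * emeasure Pinf E"
    using emeasure_P_pre_change[OF n _ E] by (simp add: add.commute[of _ n] suminf_prior_mass_tail)
  finally have 2: "(\<Sum>k. ennreal (prior_mass \<nu> k) * emeasure (P k) E) =
      ennreal ?c * emeasure Pinf E + (\<Sum>k<n. ennreal (prior_mass \<nu> k) * emeasure (P k) E)" .
  have "ennreal ((1 + A) * ?c) = ennreal ?c + ennreal (A * ?c)"
    using A c by (simp add: distrib_right)
  then have "ennreal ((1 + A) * ?c) * emeasure Pinf E =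
      ennreal ?c * emeasure Pinf E + ennreal (A * ?c) * emeasure Pinf E"
    by (simp add: distrib_right)
  also have "\<dots> \<le> ennreal ?c * emeasure Pinf E + (ennreal (prior_neg \<nu>) * emeasure (P 0) E +
      (\<Sum>k<n. ennreal (prior_mass \<nu> k) * emeasure (P k) E))"
    using 1 by (rule add_left_mono)
  also have "\<dots> = ennreal (prior_neg \<nu>) * emeasure (P 0) E +
      (\<Sum>k. ennreal (prior_mass \<nu> k) * emeasure (P k) E)"
    unfolding 2 by (simp add: ac_simps)
  finally show ?thesis .
qed

lemma suminf_emeasure_stop_le_1:
  assumes T: "T \<in> detection_procedures M N X"
  shows "(\<Sum>n. emeasure (P k) {\<omega> \<in> space M. T \<omega> = enat n}) \<le> 1"
proof -
  have "(\<Sum>n. emeasure (P k) {\<omega> \<in> space M. T \<omega> = enat n}) =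
      emeasure (P k) (\<Union>n. {\<omega> \<in> space M. T \<omega> = enat n})"
    by (rule suminf_emeasure)
      (use sets_obs_filtration_P(2)[OF detection_procedure_eq[OF T]] in
        \<open>auto simp: disjoint_family_on_def\<close>)
  also have "\<dots> \<le> 1" by (rule prob_space.emeasure_le_1[OF prob_P(1)])
  finally show ?thesis .
qed

text \<open>Summing \<open>posterior_bound\<close> over the alarm times turns the left side into
  \<open>1 + A\<close> times the PFA. The right side becomes the total probability of a finite
  alarm, at most q + (1 - q) = 1.\<close>

lemma PFA_shiryaev_time:
  assumes A: "0 \<le> A" and cdf: "\<And>n. prior_cdf \<nu> n < 1"
  shows "PFA \<nu> Pinf (shiryaev_time \<nu> g f X A) \<le> ennreal (1 / (1 + A))"
proof -
  let ?T = "shiryaev_time \<nu> g f X A"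
  let ?E = "\<lambda>n. {\<omega> \<in> space M. ?T \<omega> = enat n}" and ?c = "\<lambda>n. measure_pmf.prob \<nu> {int n..}"
  note T = shiryaev_time_detection_procedure[of \<nu> A]
  have "ennreal ((1 + A) * ?c n) * emeasure Pinf (?E n) \<le> ennreal (prior_neg \<nu>) * emeasure (P 0) (?E n)
      + (\<Sum>k. ennreal (prior_mass \<nu> k) * emeasure (P k) (?E n))" for n
  proof (cases n)
    case 0
    have E0: "?E 0 = {}" using shiryaev_time_eq_imp(1)[of \<nu> g f X A _ 0] by auto
    show ?thesis unfolding 0 E0 by simp
  next
    case (Suc j)
    show ?thesis
      by (rule posterior_bound[OF detection_procedure_eq[OF T] _ A])
        (use Suc cdf[of j] prob_atLeast_Suc[of \<nu> j] shiryaev_time_eq_imp in auto)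
  qed
  then have "(\<Sum>n. ennreal ((1 + A) * ?c n) * emeasure Pinf (?E n)) \<le>
      (\<Sum>n. ennreal (prior_neg \<nu>) * emeasure (P 0) (?E n)
      + (\<Sum>k. ennreal (prior_mass \<nu> k) * emeasure (P k) (?E n)))"
    by (intro suminf_le) auto
  also have "\<dots> = ennreal (prior_neg \<nu>) * (\<Sum>n. emeasure (P 0) (?E n))
      + (\<Sum>n. \<Sum>k. ennreal (prior_mass \<nu> k) * emeasure (P k) (?E n))"
    by (simp add: suminf_add[symmetric])
  also have "(\<Sum>n. \<Sum>k. ennreal (prior_mass \<nu> k) * emeasure (P k) (?E n)) =
      (\<Sum>k. ennreal (prior_mass \<nu> k) * (\<Sum>n. emeasure (P k) (?E n)))"
    by (subst ennreal_suminf_swap) simp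
  also have "ennreal (prior_neg \<nu>) * (\<Sum>n. emeasure (P 0) (?E n)) + \<dots> \<le>
      ennreal (prior_neg \<nu>) * 1 + (\<Sum>k. ennreal (prior_mass \<nu> k) * 1)"
    by (intro add_mono mult_left_mono suminf_le suminf_emeasure_stop_le_1 T) auto
  also have "\<dots> = 1"
    by (simp add: suminf_prior_mass flip: ennreal_plus)
  also have "(\<Sum>n. ennreal ((1 + A) * ?c n) * emeasure Pinf (?E n)) =
      ennreal (1 + A) * PFA \<nu> Pinf ?T"
    unfolding PFA_eq_suminf_stop[OF T] using A
    by (simp add: ennreal_mult mult.assoc flip: ennreal_suminf_cmult)
  finally have "ennreal (1 / (1 + A)) * (ennreal (1 + A) * PFA \<nu> Pinf ?T) \<le> ennreal (1 / (1 + A)) * 1"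
    by (intro mult_left_mono) auto
  moreover have "ennreal (1 / (1 + A)) * ennreal (1 + A) = 1"
    using A by (subst ennreal_mult[symmetric]) auto
  ultimately show ?thesis
    by (simp only: mult.assoc[symmetric] mult_1 mult_1_right)
qed

end

section \<open>Upper bound for the delay of the Shiryaev procedure\<close>

text \<open>Either b \<le> \<delta> a or a < b / \<delta>. The point is the factor on
  \<open>a\<close>: it is arbitrarily close to 1, so the leading constant of the delay is not
  spoiled, while \<open>b\<close> may be multiplied by any constant.\<close>

lemma powr_add_le_split:
  fixes a b \<delta> m :: real
  assumes "0 \<le> a" "0 \<le> b" "0 < \<delta>" "0 < m"
  shows "(a + b) powr m \<le> ((1 + \<delta>) * a) powr m + ((1 + 1 / \<delta>) * b) powr m"
proof (cases "b \<le> \<delta> * a")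
  case True
  then have "(a + b) powr m \<le> ((1 + \<delta>) * a) powr m"
    using assms by (intro powr_mono2) (auto simp: algebra_simps)
  then show ?thesis by (simp add: add_increasing2)
next
  case False
  then have "(a + b) powr m \<le> ((1 + 1 / \<delta>) * b) powr m"
    using assms by (intro powr_mono2) (auto simp: field_simps)
  then show ?thesis by (simp add: add_increasing)
qed

text \<open>Mean value theorem. The increment is bounded by a multiple of n^(r - 1), the weight in
  the complete convergence assumption, for every \<open>m\<close> \<le> \<open>r\<close> at
  once.\<close>

lemma powr_Suc_le:
  fixes m r :: real
  assumes "1 \<le> n" "0 < m" "m \<le> r" "1 \<le> r"
  shows "real (Suc n) powr m \<le> real n powr m + r * 2 powr r * real n powr (r - 1)"
proof -
  have "\<exists>z. real n < z \<and> z < real n + 1 \<and>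
      (real n + 1) powr m - real n powr m = (real n + 1 - real n) * (m * z powr (m - 1))"
    using assms by (intro MVT2) (auto intro!: derivative_eq_intros)
  then obtain z where z: "real n < z" "z < real n + 1"
    "(real n + 1) powr m - real n powr m = m * z powr (m - 1)" by auto
  \<comment> \<open>Here z > 1, so raising the exponent is monotone; this also covers m < 1, where m
    - 1 is negative.\<close>
  have "z powr (m - 1) \<le> z powr (r - 1)" using z assms by (intro powr_mono) auto
  also have "\<dots> \<le> (2 * real n) powr (r - 1)" using z assms by (intro powr_mono2) auto
  also have "\<dots> = 2 powr (r - 1) * real n powr (r - 1)" by (simp add: powr_mult)
  also have "\<dots> \<le> 2 powr r * real n powr (r - 1)" by (intro mult_right_mono powr_mono) auto
  finally have "m * z powr (m - 1) \<le> r * (2 powr r * real n powr (r - 1))"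
    using assms by (intro mult_mono) auto
  then show ?thesis using z(3) by (simp add: algebra_simps)
qed

lemma powr_add_nat_le:
  fixes m r :: real
  assumes "0 < m" "m \<le> r" "1 \<le> r"
  shows "real (Suc (N + l)) powr m \<le>
    real (Suc N) powr m + (\<Sum>j\<in>{N..<N + l}. r * 2 powr r * real (Suc j) powr (r - 1))"
proof (induction l)
  case (Suc l)
  then show ?case using powr_Suc_le[of "Suc (N + l)" m r] assms by simp
qed simp

text \<open>A pathwise form of the tail formula for moments: the power is telescoped above the level
  \<open>Suc N\<close>, and the increment at \<open>j\<close> is paid for only if the alarm comes
  after \<open>k + Suc j\<close>. Integration later turns the indicators into probabilities.\<close>

lemma delay_power_le:
  assumes "0 < m" "m \<le> r" "1 \<le> r"
  shows "delay_power m k t \<le> ennreal (real (Suc N) powr m) +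
    (\<Sum>j. ennreal (r * 2 powr r * real (Suc j) powr (r - 1)) * of_bool (N \<le> j \<and> enat (k + Suc j) < t))"
proof -
  define w where "w j = r * 2 powr r * real (Suc j) powr (r - 1)" for j
  define u where "u j = ennreal (w j) * of_bool (N \<le> j \<and> enat (k + Suc j) < t)" for j
  have w: "0 \<le> w j" for j unfolding w_def using assms by auto
  have partial: "ennreal (\<Sum>j\<in>{N..<N + l}. w j) \<le> (\<Sum>j. u j)"
    if "enat (k + (N + l)) < t \<or> l = 0" for l
  proof -
    have "ennreal (\<Sum>j\<in>{N..<N + l}. w j) = (\<Sum>j\<in>{N..<N + l}. u j)"
      unfolding sum_ennreal[OF w, symmetric]
    proof (intro sum.cong refl)
      fix j assume j: "j \<in> {N..<N + l}"
      then have "enat (k + Suc j) \<le> enat (k + (N + l))" by auto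
      with that j have "enat (k + Suc j) < t" by (auto simp del: enat_ord_simps)
      with j show "ennreal (w j) = u j" by (simp add: u_def)
    qed
    also have "\<dots> \<le> (\<Sum>j. u j)" by (rule sum_le_suminf) auto
    finally show ?thesis .
  qed
  have "delay_power m k t \<le> ennreal (real (Suc N) powr m) + (\<Sum>j. u j)"
  proof (cases t)
    case (enat i)
    show ?thesis
    proof (cases "i - k \<le> Suc N")
      case True
      then have "real (i - k) powr m \<le> real (Suc N) powr m"
        using assms by (intro powr_mono2) auto
      then show ?thesis using enat by (simp add: delay_power_def add_increasing2 ennreal_leI)
    next
      case False
      define l where "l = i - k - Suc N"
      have l: "i - k = Suc (N + l)" "k + (N + l) < i" using False by (auto simp: l_def)
      have "delay_power m k t = ennreal (real (Suc (N + l)) powr m)"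
        using enat l by (simp add: delay_power_def)
      also have "\<dots> \<le> ennreal (real (Suc N) powr m + (\<Sum>j\<in>{N..<N + l}. w j))"
        using powr_add_nat_le[OF assms, of N l] by (intro ennreal_leI) (simp add: w_def)
      also have "\<dots> = ennreal (real (Suc N) powr m) + ennreal (\<Sum>j\<in>{N..<N + l}. w j)"
        using w by (intro ennreal_plus sum_nonneg) auto
      also have "\<dots> \<le> ennreal (real (Suc N) powr m) + (\<Sum>j. u j)"
        using partial[of l] l enat by (intro add_left_mono) auto
      finally show ?thesis .
    qed
  next
    case infinity
    \<comment> \<open>For an infinite alarm time all indicators with j \<ge> \<open>N\<close> are
      on, and weights of at least 1 make the series diverge as it must.\<close>
    have "1 \<le> w j" for j
    proof -
      have "1 \<le> 2 powr r" "1 \<le> real (Suc j) powr (r - 1)"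
        using assms by (auto intro!: ge_one_powr_ge_zero)
      then have "1 * 1 * 1 \<le> r * 2 powr r * real (Suc j) powr (r - 1)"
        using assms by (intro mult_mono) auto
      then show ?thesis by (simp add: w_def)
    qed
    then have "of_nat l \<le> (\<Sum>j\<in>{N..<N + l}. w j)" for l
      using sum_mono[of "{N..<N + l}" "\<lambda>_. 1" w] by simp
    then have "ennreal (of_nat l) \<le> (\<Sum>j. u j)" for l
      using infinity by (intro order_trans[OF ennreal_leI partial[of l]]) auto
    then have "(\<Sum>j. u j) = \<infinity>"
      using ennreal_Ex_less_of_nat[of "\<Sum>j. u j"]
      by (metis ennreal_of_nat_eq_real_of_nat infinity_ennreal_def leD top.not_eq_extremum)
    then show ?thesis by simp
  qed
  then show ?thesis by (simp only: u_def w_def)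
qed

text \<open>The limit gives the exponential rate from some index on; the constant \<open>C\<close>
  absorbs the finitely many earlier ones, so that the bound holds for all \<open>n\<close>. The rate
  0 with \<open>C = 0\<close> is allowed in order to treat \<mu> = 0 alongside \<mu> > 0.\<close>

lemma prior_tail_exp_bound:
  assumes cdf: "\<And>n. prior_cdf \<nu> n < 1"
    and lim: "(\<lambda>n. \<bar>ln (1 - prior_cdf \<nu> n)\<bar> / real n) \<longlonglongrightarrow> \<mu>"
    and \<mu>': "0 \<le> \<mu>'" "\<mu>' < \<mu> \<or> \<mu>' = 0"
  obtains C where "0 \<le> C" "\<And>n. measure_pmf.prob \<nu> {int n..} \<le> exp (C - \<mu>' * real n)"
proof (cases "\<mu>' = 0")
  case True
  then show ?thesis by (intro that[of 0]) auto
next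
  case False
  then have "\<forall>\<^sub>F n in sequentially. \<mu>' < \<bar>ln (1 - prior_cdf \<nu> n)\<bar> / real n"
    using order_tendstoD(1)[OF lim] \<mu>' by auto
  then obtain n0 where n0: "\<mu>' < \<bar>ln (1 - prior_cdf \<nu> n)\<bar> / real n" if "n \<ge> n0" for n
    by (auto simp: eventually_sequentially)
  have "measure_pmf.prob \<nu> {int n..} \<le> exp (\<mu>' * (real n0 + 1) - \<mu>' * real n)" for n
  proof (cases "n0 < n")
    case True
    then obtain j where j: "n = Suc j" "n0 \<le> j" by (cases n) auto
    have "0 \<le> prior_cdf \<nu> j" by (simp add: prior_cdf_def)
    then have "ln (1 - prior_cdf \<nu> j) \<le> 0" using cdf[of j] by simp
    then have "\<mu>' < - ln (1 - prior_cdf \<nu> j) / real j" using n0[OF j(2)] by simp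
    \<comment> \<open>Division by 0 gives 0, so a quotient exceeding \<mu>' \<ge> 0 rules out
      \<open>j = 0\<close>.\<close>
    moreover have "j > 0"
      using n0[OF j(2)] \<mu>' by (cases j) auto
    ultimately have "ln (1 - prior_cdf \<nu> j) \<le> - (\<mu>' * real j)" by (simp add: field_simps)
    then have "1 - prior_cdf \<nu> j \<le> exp (- (\<mu>' * real j))"
      using cdf[of j] by (simp add: ln_le_cancel_iff[symmetric] ln_exp del: ln_le_cancel_iff)
    also have "\<dots> \<le> exp (\<mu>' * (real n0 + 1) - \<mu>' * real n)"
      using j \<mu>' by (simp add: algebra_simps)
    finally show ?thesis unfolding j(1) prob_atLeast_Suc by simp
  next
    case False
    have "measure_pmf.prob \<nu> {int n..} \<le> 1" by simp
    also have "1 \<le> exp (\<mu>' * (real n0 + 1) - \<mu>' * real n)"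
      using False \<mu>' by (simp add: mult_left_mono)
    finally show ?thesis .
  qed
  then show ?thesis using \<mu>' by (intro that[of "\<mu>' * (real n0 + 1)"]) auto
qed

lemma prior_mass_le_tail: "prior_mass \<nu> k \<le> measure_pmf.prob \<nu> {int k..}"
  unfolding prior_mass_def measure_pmf_single[symmetric]
  by (intro measure_pmf.finite_measure_mono) auto

text \<open>With y = |ln x|, the inequality 1 + u \<le> exp u at u = y / (2 r) yields y^r \<le> (2
  r)^r exp (y / 2): the logarithm costs only half of the decay of \<open>x\<close>.\<close>

lemma mult_abs_ln_powr_le:
  fixes x r :: real
  assumes "0 \<le> x" "x \<le> 1" "0 < r"
  shows "x * \<bar>ln x\<bar> powr r \<le> (2 * r) powr r * sqrt x"
proof (cases "x = 0")
  case False
  define y where "y = - ln x"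
  have x: "x = exp (- y)" "0 \<le> y" "\<bar>ln x\<bar> = y" using assms False by (auto simp: y_def)
  have "y / (2 * r) \<le> exp (y / (2 * r))" using exp_ge_add_one_self[of "y / (2 * r)"] by linarith
  then have "y \<le> 2 * r * exp (y / (2 * r))" using assms by (simp add: field_simps)
  then have "y powr r \<le> (2 * r * exp (y / (2 * r))) powr r" using x assms by (intro powr_mono2) auto
  also have "\<dots> = (2 * r) powr r * exp (y / 2)"
    using assms by (simp add: powr_mult exp_powr_real)
  finally have "x * y powr r \<le> exp (- y) * ((2 * r) powr r * exp (y / 2))"
    unfolding x(1) by (intro mult_left_mono) auto
  also have "\<dots> = (2 * r) powr r * exp (- y / 2)" by (simp add: mult.left_commute flip: exp_add)
  also have "exp (- y / 2) = sqrt x"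
    unfolding x(1) by (rule real_sqrt_unique[symmetric]) (auto simp: power2_eq_square simp flip: exp_add)
  finally show ?thesis using x by simp
qed simp

text \<open>For \<mu> > 0 each \<pi>_k lies below a tail that decays at the rate \<mu> / 2, and
  after the loss of a square root a geometric series remains.\<close>

lemma prior_log_moment_exp:
  assumes cdf: "\<And>n. prior_cdf \<nu> n < 1"
    and lim: "(\<lambda>n. \<bar>ln (1 - prior_cdf \<nu> n)\<bar> / real n) \<longlonglongrightarrow> \<mu>"
    and "0 < \<mu>" "0 < r"
  shows "summable (\<lambda>k. prior_mass \<nu> k * \<bar>ln (prior_mass \<nu> k)\<bar> powr r)"
proof -
  have "0 \<le> \<mu> / 2" "\<mu> / 2 < \<mu> \<or> \<mu> / 2 = 0" using assms by auto
  from prior_tail_exp_bound[OF cdf lim this]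
  obtain C where C: "\<And>n. measure_pmf.prob \<nu> {int n..} \<le> exp (C - \<mu> / 2 * real n)" by blast
  have bound: "norm (prior_mass \<nu> k * \<bar>ln (prior_mass \<nu> k)\<bar> powr r) \<le>
      (2 * r) powr r * exp (C / 2) * exp (- \<mu> / 4) ^ k" for k
  proof -
    have "sqrt (prior_mass \<nu> k) \<le> sqrt (exp (C - \<mu> / 2 * real k))"
      using prior_mass_le_tail[of \<nu> k] C[of k] by simp
    also have "\<dots> = exp (C / 2 - \<mu> / 4 * real k)"
      by (rule real_sqrt_unique) (auto simp: power2_eq_square simp flip: exp_add)
    also have "\<dots> = exp (C / 2) * exp (- \<mu> / 4) ^ k"
      by (simp add: mult.commute flip: exp_add exp_of_nat_mult)
    finally have sqrt_le: "(2 * r) powr r * sqrt (prior_mass \<nu> k) \<le>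
        (2 * r) powr r * (exp (C / 2) * exp (- \<mu> / 4) ^ k)"
      by (intro mult_left_mono) auto
    have "norm (prior_mass \<nu> k * \<bar>ln (prior_mass \<nu> k)\<bar> powr r) =
        prior_mass \<nu> k * \<bar>ln (prior_mass \<nu> k)\<bar> powr r" by simp
    also have "\<dots> \<le> (2 * r) powr r * sqrt (prior_mass \<nu> k)"
      by (intro mult_abs_ln_powr_le prior_mass_le_1 \<open>0 < r\<close>) simp
    also note sqrt_le
    finally show ?thesis by (simp only: mult.assoc)
  qed
  have "summable (\<lambda>k. (2 * r) powr r * exp (C / 2) * exp (- \<mu> / 4) ^ k)"
    using \<open>0 < \<mu>\<close> by (intro summable_mult summable_geometric) auto
  then show ?thesis by (rule summable_comparison_test'[of _ 0]) (rule bound)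
qed

text \<open>Since \<open>b\<close> \<ge> 1, the base is at least 1 and the exponent \<open>m\<close>
  may be raised to \<open>r\<close>; the split with \<delta> = 1 then reduces to the moment of order
  \<open>r\<close>.\<close>

lemma prior_log_moment_affine:
  fixes a b m r :: real
  assumes sm: "summable (\<lambda>k. prior_mass \<nu> k * \<bar>ln (prior_mass \<nu> k)\<bar> powr r)"
    and "0 \<le> a" "1 \<le> b" "0 < m" "m \<le> r"
  shows "summable (\<lambda>k. prior_mass \<nu> k * (a * \<bar>ln (prior_mass \<nu> k)\<bar> + b) powr m)"
proof (rule summable_comparison_test'[of _ 0])
  let ?l = "\<lambda>k. \<bar>ln (prior_mass \<nu> k)\<bar>"
  have "summable (\<lambda>k. (2 * a) powr r * (prior_mass \<nu> k * ?l k powr r) + (2 * b) powr r * prior_mass \<nu> k)"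
    by (intro summable_add summable_mult sm prior_mass_summable)
  then show "summable (\<lambda>k. prior_mass \<nu> k * ((2 * a * ?l k) powr r + (2 * b) powr r))"
    using assms by (simp add: powr_mult algebra_simps)
  fix k
  have "(a * ?l k + b) powr m \<le> (a * ?l k + b) powr r"
    using assms by (intro powr_mono) (auto intro: add_increasing)
  also have "\<dots> \<le> (2 * a * ?l k) powr r + (2 * b) powr r"
    using powr_add_le_split[of "a * ?l k" b 1 r] assms by (simp add: mult.assoc)
  finally show "norm (prior_mass \<nu> k * (a * ?l k + b) powr m) \<le>
      prior_mass \<nu> k * ((2 * a * ?l k) powr r + (2 * b) powr r)"
    by (simp add: mult_left_mono)
qed

section \<open>From late alarms to deviations of the log-likelihood ratio\<close>

context change_point_model
begin

definition llr_deviation :: "real \<Rightarrow> real \<Rightarrow> nat \<Rightarrow> nat \<Rightarrow> 'w set" where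
  "llr_deviation I \<epsilon> k n =
     {\<omega> \<in> space M. \<bar>1 / real n * log_likelihood_sum g f X k n \<omega> - I\<bar> > \<epsilon>}"

lemma llr_deviation_sets [measurable]: "llr_deviation I \<epsilon> k n \<in> sets (P k)"
proof -
  have [measurable]: "log_likelihood_sum g f X k n \<in> borel_measurable M"
    by (rule log_likelihood_sum_measurable)
  have "llr_deviation I \<epsilon> k n \<in> sets M" unfolding llr_deviation_def by measurable
  then show ?thesis using prob_P by simp
qed

text \<open>No alarm by time \<open>k + n\<close> forces \<pi>_k exp \<lambda> < A P(\<nu> \<ge> k +
  n). In logarithms the prior tail adds \<mu>' n to the drift, so under \<open>large\<close> the sum
  \<lambda> stays below I' n, and the gap between I' and I exceeds \<epsilon>.\<close>

lemma shiryaev_time_gt_imp_deviation: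
  assumes \<omega>: "\<omega> \<in> space M" and pos: "0 < lr_prod k (k + n) \<omega>"
    and gt: "enat (k + n) < shiryaev_time \<nu> g f X A \<omega>"
    and n: "1 \<le> n" and A: "0 < A" and pk: "0 < prior_mass \<nu> k"
    and I': "I' + \<epsilon> < I" and \<mu>': "0 \<le> \<mu>'"
    and tail: "measure_pmf.prob \<nu> {int (k + n)..} \<le> exp (C - \<mu>' * real (k + n))"
    and tail_pos: "0 < measure_pmf.prob \<nu> {int (k + n)..}"
    and large: "ln A + \<bar>ln (prior_mass \<nu> k)\<bar> + C \<le> (I' + \<mu>') * real n"
  shows "\<omega> \<in> llr_deviation I \<epsilon> k n"
proof -
  let ?c = "measure_pmf.prob \<nu> {int (k + n)..}" and ?L = "log_likelihood_sum g f X k n \<omega>"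
  have "\<not> (\<exists>j\<in>{1..k + n}. A \<le> shiryaev_statistic \<nu> g f X j \<omega>)"
    using gt unfolding shiryaev_time_le_iff[symmetric] by simp
  then have "shiryaev_statistic \<nu> g f X (k + n) \<omega> < A" using n by (metis add_increasing atLeastAtMost_iff le_refl not_le zero_le)
  then have "prior_neg \<nu> * lr_prod 0 (k + n) \<omega> + (\<Sum>j<k + n. prior_mass \<nu> j * lr_prod j (k + n) \<omega>)
      < A * ?c"
    using tail_pos by (simp add: shiryaev_statistic_lr_prod field_simps)
  moreover have "0 \<le> prior_neg \<nu> * lr_prod 0 (k + n) \<omega>" using lr_prod_nonneg[OF \<omega>] by simp
  moreover have "prior_mass \<nu> k * lr_prod k (k + n) \<omega> \<le>
      (\<Sum>j<k + n. prior_mass \<nu> j * lr_prod j (k + n) \<omega>)"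
    using n lr_prod_nonneg[OF \<omega>] by (intro member_le_sum) auto
  ultimately have "prior_mass \<nu> k * exp ?L < A * ?c"
    using lr_prod_le_exp(2)[OF \<omega> pos] by simp
  also have "\<dots> \<le> A * exp (C - \<mu>' * real (k + n))" using tail A by (intro mult_left_mono) auto
  \<comment> \<open>The gain exp (-\<mu>' k) is given up; the remaining bound depends on
    \<open>k\<close> only through \<pi>_k.\<close>
  also have "\<dots> \<le> A * exp (C - \<mu>' * real n)" using A \<mu>' by (simp add: algebra_simps)
  finally have "ln (prior_mass \<nu> k * exp ?L) < ln (A * exp (C - \<mu>' * real n))"
    using pk A by (subst ln_less_cancel_iff) auto
  then have "ln (prior_mass \<nu> k) + ?L < ln A + C - \<mu>' * real n"
    using pk A by (simp add: ln_mult)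
  then have "?L < I' * real n" using large by (simp add: algebra_simps)
  then have "1 / real n * ?L < I'" using n by (simp add: field_simps)
  then show ?thesis using \<omega> I' by (simp add: llr_deviation_def)
qed

lemma shiryaev_delay_integral_le:
  assumes m: "0 < m" "m \<le> r" "1 \<le> r" and A: "1 \<le> A" and pk: "0 < prior_mass \<nu> k"
    and I': "0 < I'" "I' + \<epsilon> < I" and \<mu>': "0 \<le> \<mu>'" and C: "0 \<le> C"
    and cdf: "\<And>n. prior_cdf \<nu> n < 1"
    and tail: "\<And>n. measure_pmf.prob \<nu> {int n..} \<le> exp (C - \<mu>' * real n)"
  shows "(\<integral>\<^sup>+\<omega>. delay_power m k (shiryaev_time \<nu> g f X A \<omega>) \<partial>P k) \<le>
    ennreal (((ln A + \<bar>ln (prior_mass \<nu> k)\<bar> + C) / (I' + \<mu>') + 1) powr m) +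
    ennreal (r * 2 powr r) * (\<Sum>j. ennreal (real (Suc j) powr (r - 1)) *
      emeasure (P k) (llr_deviation I \<epsilon> k (Suc j)))"
proof -
  let ?T = "shiryaev_time \<nu> g f X A"
  \<comment> \<open>\<open>y\<close> solves the condition \<open>large\<close> of
    \<open>shiryaev_time_gt_imp_deviation\<close> with equality; beyond \<open>N\<close> every late
    alarm is a deviation.\<close>
  define y where "y = (ln A + \<bar>ln (prior_mass \<nu> k)\<bar> + C) / (I' + \<mu>')"
  define N where "N = nat \<lfloor>y\<rfloor>"
  have s: "0 < I' + \<mu>'" using I' \<mu>' by simp
  have y: "0 \<le> y" unfolding y_def using A C s by (intro divide_nonneg_pos) auto
  have N: "real (Suc N) \<le> y + 1" "y < real (Suc N)" using y unfolding N_def by linarith+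
  \<comment> \<open>One null set for all horizons, because the pathwise series below involves every
    \<open>j\<close>.\<close>
  have AE: "AE \<omega> in P k. \<forall>j. 0 < lr_prod k (k + Suc j) \<omega>"
    unfolding AE_all_countable by (intro allI AE_lr_prod_pos) auto
  let ?w = "\<lambda>j. ennreal (r * 2 powr r * real (Suc j) powr (r - 1))"
  have "(\<integral>\<^sup>+\<omega>. delay_power m k (?T \<omega>) \<partial>P k) \<le>
      (\<integral>\<^sup>+\<omega>. ennreal (real (Suc N) powr m) +
        (\<Sum>j. ?w j * indicator (llr_deviation I \<epsilon> k (Suc j)) \<omega>) \<partial>P k)"
  proof (rule nn_integral_mono_AE, use AE AE_space in eventually_elim)
    fix \<omega> assume pos: "\<forall>j. 0 < lr_prod k (k + Suc j) \<omega>" and "\<omega> \<in> space (P k)"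
    then have \<omega>: "\<omega> \<in> space M" by simp
    have dev: "\<omega> \<in> llr_deviation I \<epsilon> k (Suc j)" if "N \<le> j" "enat (k + Suc j) < ?T \<omega>" for j
    proof (rule shiryaev_time_gt_imp_deviation[OF \<omega> _ that(2) _ _ pk I'(2) \<mu>' tail])
      have "y \<le> real (Suc j)" using N that by linarith
      then show "ln A + \<bar>ln (prior_mass \<nu> k)\<bar> + C \<le> (I' + \<mu>') * real (Suc j)"
        using s by (simp add: y_def field_simps)
      show "0 < measure_pmf.prob \<nu> {int (k + Suc j)..}"
        using prob_atLeast_Suc[of \<nu> "k + j"] cdf[of "k + j"] by simp
    qed (use A pos in auto)
    show "delay_power m k (?T \<omega>) \<le> ennreal (real (Suc N) powr m) +
        (\<Sum>j. ?w j * indicator (llr_deviation I \<epsilon> k (Suc j)) \<omega>)"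
      by (rule order_trans[OF delay_power_le[OF m, of k "?T \<omega>" N]])
        (intro add_left_mono suminf_le mult_left_mono, use dev in \<open>auto simp: indicator_def\<close>)
  qed
  also have "\<dots> = ennreal (real (Suc N) powr m) +
      (\<Sum>j. ?w j * emeasure (P k) (llr_deviation I \<epsilon> k (Suc j)))"
    by (subst nn_integral_add)
      (auto simp: nn_integral_suminf nn_integral_cmult prob_space.emeasure_space_1[OF prob_P(1), simplified])
  also have "(\<Sum>j. ?w j * emeasure (P k) (llr_deviation I \<epsilon> k (Suc j))) =
      ennreal (r * 2 powr r) * (\<Sum>j. ennreal (real (Suc j) powr (r - 1)) *
        emeasure (P k) (llr_deviation I \<epsilon> k (Suc j)))"
    using m by (simp add: ennreal_mult mult.assoc flip: ennreal_suminf_cmult)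
  also have "ennreal (real (Suc N) powr m) \<le> ennreal ((y + 1) powr m)"
    using N y m by (intro ennreal_leI powr_mono2) auto
  finally show ?thesis by (simp add: y_def)
qed

text \<open>\<open>powr_add_le_split\<close> detaches ln A from |ln \<pi>_k|, so only the first
  summand grows with \<open>A\<close>. The rest, summed over the prior, is finite by the logarithmic
  moment and by complete convergence, and forms the constant \<open>K\<close>.\<close>

lemma shiryaev_delay_sum_le:
  assumes m: "0 < m" "m \<le> r" "1 \<le> r" and \<delta>: "0 < \<delta>"
    and I': "0 < I'" "I' < I" and \<mu>': "0 \<le> \<mu>'" "\<mu>' < \<mu> \<or> \<mu>' = 0"
    and cdf: "\<And>n. prior_cdf \<nu> n < 1"
    and lim: "(\<lambda>n. \<bar>ln (1 - prior_cdf \<nu> n)\<bar> / real n) \<longlonglongrightarrow> \<mu>"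
    and log_moment: "summable (\<lambda>k. prior_mass \<nu> k * \<bar>ln (prior_mass \<nu> k)\<bar> powr r)"
    and rc: "\<And>\<epsilon>. 0 < \<epsilon> \<Longrightarrow> (\<Sum>k. ennreal (prior_mass \<nu> k) *
         (\<Sum>j. ennreal (real (Suc j) powr (r - 1)) * emeasure (P k) (llr_deviation I \<epsilon> k (Suc j)))) < \<infinity>"
  obtains K where "0 \<le> K" "\<And>A. 1 \<le> A \<Longrightarrow>
    (\<Sum>k. ennreal (prior_mass \<nu> k) * (\<integral>\<^sup>+\<omega>. delay_power m k (shiryaev_time \<nu> g f X A \<omega>) \<partial>P k)) \<le>
    ennreal ((1 - prior_neg \<nu>) * ((1 + \<delta>) * ln A / (I' + \<mu>')) powr m + K)"
proof -
  obtain C where C: "0 \<le> C" "\<And>n. measure_pmf.prob \<nu> {int n..} \<le> exp (C - \<mu>' * real n)"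
    using prior_tail_exp_bound[OF cdf lim \<mu>'] by auto
  \<comment> \<open>Half of the gap between I' and I, as the strict inequality I' + \<epsilon> < I
    is required.\<close>
  define \<epsilon> where "\<epsilon> = (I - I') / 2"
  have \<epsilon>: "0 < \<epsilon>" "I' + \<epsilon> < I" using I' by (auto simp: \<epsilon>_def field_simps)
  define s where "s = I' + \<mu>'"
  have s: "0 < s" using I' \<mu>' by (simp add: s_def)
  define R where "R k = (\<Sum>j. ennreal (real (Suc j) powr (r - 1)) *
    emeasure (P k) (llr_deviation I \<epsilon> k (Suc j)))" for k
  define B where "B k = ((1 + 1 / \<delta>) * ((\<bar>ln (prior_mass \<nu> k)\<bar> + C) / s + 1)) powr m" for k
  define S where "S = (\<Sum>k. ennreal (prior_mass \<nu> k * B k)) +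
    ennreal (r * 2 powr r) * (\<Sum>k. ennreal (prior_mass \<nu> k) * R k)"
  have "summable (\<lambda>k. prior_mass \<nu> k * (((1 + 1 / \<delta>) / s) * \<bar>ln (prior_mass \<nu> k)\<bar> +
      (1 + 1 / \<delta>) * (C / s + 1)) powr m)"
  proof (rule prior_log_moment_affine[OF log_moment _ _ m(1,2)])
    have "1 * 1 \<le> (1 + 1 / \<delta>) * (C / s + 1)" using \<delta> C s by (intro mult_mono) auto
    then show "1 \<le> (1 + 1 / \<delta>) * (C / s + 1)" by simp
  qed (use \<delta> s in auto)
  moreover have "B k = (((1 + 1 / \<delta>) / s) * \<bar>ln (prior_mass \<nu> k)\<bar> +
      (1 + 1 / \<delta>) * (C / s + 1)) powr m" for k
    unfolding B_def by (rule arg_cong[of _ _ "\<lambda>x. x powr m"]) (use \<delta> s in \<open>simp add: field_simps\<close>)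
  ultimately have "summable (\<lambda>k. prior_mass \<nu> k * B k)" by simp
  then have "(\<Sum>k. ennreal (prior_mass \<nu> k * B k)) < \<infinity>"
    by (subst suminf_ennreal2) (auto simp: B_def)
  then have S: "S < \<infinity>"
    using rc[OF \<epsilon>(1)] unfolding S_def R_def[symmetric]
    by (simp add: ennreal_mult_less_top)
  show ?thesis
  proof (rule that[of "enn2real S"])
    fix A :: real assume A: "1 \<le> A"
    let ?a = "((1 + \<delta>) * ln A / s) powr m"
    have "ennreal (prior_mass \<nu> k) * (\<integral>\<^sup>+\<omega>. delay_power m k (shiryaev_time \<nu> g f X A \<omega>) \<partial>P k) \<le>
        ennreal (prior_mass \<nu> k) * ennreal ?a + (ennreal (prior_mass \<nu> k * B k) +
        ennreal (r * 2 powr r) * (ennreal (prior_mass \<nu> k) * R k))" for k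
    proof (cases "prior_mass \<nu> k = 0")
      case False
      then have pk: "0 < prior_mass \<nu> k" using prior_mass_nonneg[of \<nu> k] by linarith
      have "((ln A + \<bar>ln (prior_mass \<nu> k)\<bar> + C) / s + 1) powr m =
          (ln A / s + ((\<bar>ln (prior_mass \<nu> k)\<bar> + C) / s + 1)) powr m"
        by (simp add: add_divide_distrib algebra_simps)
      also have "\<dots> \<le> ?a + B k"
        unfolding B_def using powr_add_le_split[of "ln A / s" "(\<bar>ln (prior_mass \<nu> k)\<bar> + C) / s + 1" \<delta> m]
          A C s \<delta> m by simp
      finally have "ennreal (((ln A + \<bar>ln (prior_mass \<nu> k)\<bar> + C) / s + 1) powr m) \<le>
          ennreal ?a + ennreal (B k)"
        by (subst ennreal_plus[symmetric]) (auto simp: B_def simp del: ennreal_plus intro: ennreal_leI)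
      then have "(\<integral>\<^sup>+\<omega>. delay_power m k (shiryaev_time \<nu> g f X A \<omega>) \<partial>P k) \<le>
          ennreal ?a + ennreal (B k) + ennreal (r * 2 powr r) * R k"
        using shiryaev_delay_integral_le[OF m A pk I'(1) \<epsilon>(2) \<mu>'(1) C(1) cdf C(2)]
        unfolding R_def s_def by (rule order_trans[OF _ add_right_mono, rotated])
      then have "ennreal (prior_mass \<nu> k) * (\<integral>\<^sup>+\<omega>. delay_power m k (shiryaev_time \<nu> g f X A \<omega>) \<partial>P k) \<le>
          ennreal (prior_mass \<nu> k) * (ennreal ?a + ennreal (B k) + ennreal (r * 2 powr r) * R k)"
        by (rule mult_left_mono) simp
      also have "\<dots> = ennreal (prior_mass \<nu> k) * ennreal ?a + (ennreal (prior_mass \<nu> k * B k) +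
        ennreal (r * 2 powr r) * (ennreal (prior_mass \<nu> k) * R k))"
        by (simp add: B_def ennreal_mult distrib_left ac_simps)
      finally show ?thesis .
    qed simp
    then have "(\<Sum>k. ennreal (prior_mass \<nu> k) * (\<integral>\<^sup>+\<omega>. delay_power m k (shiryaev_time \<nu> g f X A \<omega>) \<partial>P k)) \<le>
        (\<Sum>k. ennreal (prior_mass \<nu> k) * ennreal ?a + (ennreal (prior_mass \<nu> k * B k) +
        ennreal (r * 2 powr r) * (ennreal (prior_mass \<nu> k) * R k)))"
      by (intro suminf_le) auto
    also have "\<dots> = ennreal (1 - prior_neg \<nu>) * ennreal ?a + S"
      unfolding S_def by (simp add: suminf_add[symmetric] suminf_prior_mass)
    also have "\<dots> = ennreal ((1 - prior_neg \<nu>) * ?a + enn2real S)"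
      using S by (simp add: ennreal_mult ennreal_enn2real)
    finally show "(\<Sum>k. ennreal (prior_mass \<nu> k) * (\<integral>\<^sup>+\<omega>. delay_power m k (shiryaev_time \<nu> g f X A \<omega>) \<partial>P k)) \<le>
      ennreal ((1 - prior_neg \<nu>) * ((1 + \<delta>) * ln A / (I' + \<mu>')) powr m + enn2real S)"
      unfolding s_def .
  qed simp
qed

end

section \<open>Lower bound for the delay of an arbitrary procedure\<close>

lemma prior_tail_exp_lower_bound:
  assumes cdf: "\<And>n. prior_cdf \<nu> n < 1"
    and lim: "(\<lambda>n. \<bar>ln (1 - prior_cdf \<nu> n)\<bar> / real n) \<longlonglongrightarrow> \<mu>"
    and \<mu>': "0 \<le> \<mu>" "\<mu> < \<mu>'"
  shows "\<forall>\<^sub>F n in sequentially. exp (- \<mu>' * real n) \<le> measure_pmf.prob \<nu> {int n..}"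
proof -
  have "\<forall>\<^sub>F n in sequentially. exp (- \<mu>' * real (Suc n)) \<le> measure_pmf.prob \<nu> {int (Suc n)..}"
    using order_tendstoD(2)[OF lim \<mu>'(2)] eventually_gt_at_top[of 0]
  proof eventually_elim
    case (elim n)
    then have "- ln (1 - prior_cdf \<nu> n) \<le> \<mu>' * real n" by (simp add: field_simps)
    also have "\<dots> \<le> \<mu>' * real (Suc n)" using \<mu>' by (intro mult_left_mono) auto
    finally have "- \<mu>' * real (Suc n) \<le> ln (1 - prior_cdf \<nu> n)" by simp
    then show ?case
      unfolding prob_atLeast_Suc using cdf[of n] by (subst (asm) ln_ge_iff) auto
  qed
  then show ?thesis by (subst (asm) eventually_sequentially_Suc)
qed

context change_point_model
begin

text \<open>Union bound and dominated convergence for series, instead of a maximal inequality. For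
  fixed \<open>j\<close> the probability tends to 0 as the level rises; for j < N the level is at
  least (I + \<epsilon>) (j + 1), so the event is a deviation at time j + 1, whose probabilities are
  summable.\<close>

lemma llr_max_tendsto_0:
  assumes sm: "(\<Sum>j. emeasure (P k) (llr_deviation I \<epsilon> k (Suc j))) < \<infinity>"
    and I: "0 < I" "0 < \<epsilon>"
  shows "(\<lambda>N. measure (P k) (\<Union>j<N. {\<omega> \<in> space M. (I + \<epsilon>) * real N < log_likelihood_sum g f X k (Suc j) \<omega>}))
    \<longlonglongrightarrow> 0"
proof -
  interpret Pk: prob_space "P k" by (rule prob_P)
  define E where "E j N = {\<omega> \<in> space M. (I + \<epsilon>) * real N < log_likelihood_sum g f X k (Suc j) \<omega>}" for j N
  \<comment> \<open>Extension by 0 beyond \<open>N\<close> gives a series over a fixed index set, as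
    Tannery's theorem requires.\<close>
  define a where "a j N = (if j < N then Pk.prob (E j N) else 0)" for j N
  have E: "E j N \<in> sets (P k)" for j N
  proof -
    have [measurable]: "log_likelihood_sum g f X k (Suc j) \<in> borel_measurable M"
      by (rule log_likelihood_sum_measurable)
    have "E j N \<in> sets M" unfolding E_def by measurable
    then show ?thesis using prob_P by simp
  qed
  have lim: "(\<lambda>N. a j N) \<longlonglongrightarrow> 0" for j
  proof (rule Lim_null_comparison)
    have "(\<Inter>N. E j N) = {}"
    proof -
      have "\<exists>N. \<not> (I + \<epsilon>) * real N < x" for x
      proof -
        obtain N where "x / (I + \<epsilon>) < real N" using reals_Archimedean2 by blast
        then show ?thesis using I by (intro exI[of _ N]) (simp add: field_simps)
      qed
      then show ?thesis unfolding E_def by blast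
    qed
    moreover have "decseq (E j)"
    proof (rule decseq_SucI)
      fix N
      have "(I + \<epsilon>) * real N \<le> (I + \<epsilon>) * real (Suc N)" using I by (intro mult_left_mono) auto
      then show "E j (Suc N) \<subseteq> E j N" unfolding E_def by auto
    qed
    ultimately show "(\<lambda>N. Pk.prob (E j N)) \<longlonglongrightarrow> 0"
      using Pk.finite_Lim_measure_decseq[of "E j"] E by auto
  qed (auto simp: a_def)
  have bound: "norm (a j N) \<le> Pk.prob (llr_deviation I \<epsilon> k (Suc j))" for j N
  proof (cases "j < N")
    case True
    have "E j N \<subseteq> llr_deviation I \<epsilon> k (Suc j)"
    proof
      fix \<omega> assume \<omega>: "\<omega> \<in> E j N"
      have "(I + \<epsilon>) * real (Suc j) \<le> (I + \<epsilon>) * real N" using True I by (intro mult_left_mono) auto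
      then have "I + \<epsilon> < 1 / real (Suc j) * log_likelihood_sum g f X k (Suc j) \<omega>"
        using \<omega> by (simp add: E_def field_simps)
      then show "\<omega> \<in> llr_deviation I \<epsilon> k (Suc j)"
        using \<omega> by (simp add: E_def llr_deviation_def)
    qed
    then show ?thesis using True by (simp add: a_def Pk.finite_measure_mono)
  qed (simp add: a_def)
  have "summable (\<lambda>j. Pk.prob (llr_deviation I \<epsilon> k (Suc j)))"
    using sm unfolding Pk.emeasure_eq_measure by (intro summable_suminf_not_top) auto
  moreover have "\<forall>\<^sub>F (j, N) in sequentially \<times>\<^sub>F sequentially.
      norm (a j N) \<le> Pk.prob (llr_deviation I \<epsilon> k (Suc j))"
    using bound by (intro always_eventually) auto
  ultimately have "(\<lambda>N. \<Sum>j. a j N) \<longlonglongrightarrow> (\<Sum>j. 0)"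
    using tannerys_theorem[of a "\<lambda>_. 0" sequentially "\<lambda>j. Pk.prob (llr_deviation I \<epsilon> k (Suc j))",
        OF lim _ _ sequentially_bot] by blast
  moreover have "(\<Sum>j. a j N) = (\<Sum>j<N. Pk.prob (E j N))" for N
    by (subst suminf_finite[of "{..<N}"]) (auto simp: a_def)
  ultimately have "(\<lambda>N. \<Sum>j<N. Pk.prob (E j N)) \<longlonglongrightarrow> 0" by simp
  then show ?thesis
    unfolding E_def[symmetric]
    by (rule Lim_null_comparison[rotated])
      (intro always_eventually allI, use E in \<open>auto intro!: Pk.finite_measure_subadditive_finite\<close>)
qed

text \<open>The measure is changed separately on each event T = k + j + 1, at its own finite
  horizon. Where the ratio is at most exp b this costs a factor exp b, and disjointness reassembles
  the pieces under \<open>Pinf\<close>; a larger ratio is covered by the last term.\<close>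

lemma emeasure_early_stop_le:
  assumes T: "T \<in> detection_procedures M N X"
  shows "emeasure (P k) {\<omega> \<in> space M. enat k < T \<omega> \<and> T \<omega> \<le> enat (k + L)} \<le>
    ennreal (exp b) * emeasure Pinf {\<omega> \<in> space M. T \<omega> \<le> enat (k + L)} +
    emeasure (P k) (\<Union>j<L. {\<omega> \<in> space M. b < log_likelihood_sum g f X k (Suc j) \<omega>})"
proof -
  let ?\<Lambda> = "\<lambda>j. lr_prod k (k + Suc j)"
  define S where "S j = {\<omega> \<in> space M. T \<omega> = enat (k + Suc j)}" for j
  define E where "E j = S j \<inter> {\<omega> \<in> space M. ?\<Lambda> j \<omega> \<le> exp b}" for j
  define U where "U = (\<Union>j<L. {\<omega> \<in> space M. b < log_likelihood_sum g f X k (Suc j) \<omega>})"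
  have S: "S j \<in> sets (obs_filtration (k + Suc j))" for j
    unfolding S_def by (rule detection_procedure_eq[OF T])
  have E: "E j \<in> sets (obs_filtration (k + Suc j))" for j
    unfolding E_def using borel_measurable_le[OF lr_prod_measurable borel_measurable_const, of "k + Suc j" k "exp b"]
    by (intro sets.Int S) simp
  have U: "U \<in> sets (P k)"
  proof -
    have [measurable]: "log_likelihood_sum g f X k n \<in> borel_measurable M" for n
      by (rule log_likelihood_sum_measurable)
    have "U \<in> sets M" unfolding U_def by measurable
    then show ?thesis using prob_P by simp
  qed
  have "{\<omega> \<in> space M. enat k < T \<omega> \<and> T \<omega> \<le> enat (k + L)} \<subseteq> (\<Union>j<L. E j) \<union> U"
  proof
    fix \<omega> assume "\<omega> \<in> {\<omega> \<in> space M. enat k < T \<omega> \<and> T \<omega> \<le> enat (k + L)}"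
    then obtain n where n: "\<omega> \<in> space M" "T \<omega> = enat n" "k < n" "n \<le> k + L"
      by (cases "T \<omega>") auto
    then have j: "n = k + Suc (n - k - 1)" "n - k - 1 < L" by auto
    show "\<omega> \<in> (\<Union>j<L. E j) \<union> U"
    proof (cases "\<omega> \<in> U")
      case False
      then have "log_likelihood_sum g f X k (Suc (n - k - 1)) \<omega> \<le> b"
        using j(2) n(1) unfolding U_def by (auto simp: not_less)
      then have "?\<Lambda> (n - k - 1) \<omega> \<le> exp b"
        by (intro order_trans[OF lr_prod_le_exp(1)[OF n(1)]]) simp
      then have "\<omega> \<in> E (n - k - 1)" using n j(1) unfolding E_def S_def by auto
      then show ?thesis using j(2) by blast
    qed blast
  qed
  then have "emeasure (P k) {\<omega> \<in> space M. enat k < T \<omega> \<and> T \<omega> \<le> enat (k + L)} \<le>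
      emeasure (P k) ((\<Union>j<L. E j) \<union> U)"
    using U sets_obs_filtration_P(2)[OF E] by (intro emeasure_mono) auto
  also have "\<dots> \<le> emeasure (P k) (\<Union>j<L. E j) + emeasure (P k) U"
    using U sets_obs_filtration_P(2)[OF E] by (intro emeasure_subadditive) auto
  also have "emeasure (P k) (\<Union>j<L. E j) \<le> (\<Sum>j<L. emeasure (P k) (E j))"
    using sets_obs_filtration_P(2)[OF E] by (intro emeasure_subadditive_finite) auto
  also have "\<dots> \<le> (\<Sum>j<L. ennreal (exp b) * emeasure Pinf (S j))"
  proof (rule sum_mono)
    fix j
    have "emeasure (P k) (E j) = (\<integral>\<^sup>+\<omega>. ennreal (?\<Lambda> j \<omega>) * indicator (E j) \<omega> \<partial>Pinf)"
      by (rule change_of_measure) (use E in auto)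
    also have "\<dots> \<le> (\<integral>\<^sup>+\<omega>. ennreal (exp b) * indicator (S j) \<omega> \<partial>Pinf)"
      by (intro nn_integral_mono) (auto simp: E_def indicator_def intro: ennreal_leI)
    also have "\<dots> = ennreal (exp b) * emeasure Pinf (S j)"
      using sets_obs_filtration_P(3)[OF S] by (simp add: nn_integral_cmult_indicator)
    finally show "emeasure (P k) (E j) \<le> ennreal (exp b) * emeasure Pinf (S j)" .
  qed
  also have "\<dots> = ennreal (exp b) * emeasure Pinf (\<Union>j<L. S j)"
    unfolding sum_distrib_left[symmetric]
    by (subst sum_emeasure)
      (use sets_obs_filtration_P(3)[OF S] in \<open>auto simp: disjoint_family_on_def S_def\<close>)
  also have "emeasure Pinf (\<Union>j<L. S j) \<le> emeasure Pinf {\<omega> \<in> space M. T \<omega> \<le> enat (k + L)}"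
    using sets_obs_filtration_P(3)[OF detection_procedure_le[OF T]]
    by (intro emeasure_mono) (auto simp: S_def)
  finally show ?thesis unfolding U_def by (simp add: add_right_mono mult_left_mono)
qed

text \<open>With s = I + \<mu> this is a little less than the optimal first-order delay: too few
  observations for an alarm that respects the constraint.\<close>

definition early_horizon :: "real \<Rightarrow> real \<Rightarrow> real \<Rightarrow> nat" where
  "early_horizon \<delta> s \<alpha> = nat \<lfloor>(1 - \<delta>) * \<bar>ln \<alpha>\<bar> / s\<rfloor>"

lemma filterlim_early_horizon:
  assumes "\<delta> < 1" "0 < s"
  shows "filterlim (early_horizon \<delta> s) sequentially (at_right 0)"
  unfolding early_horizon_def using assms
  by real_asymp

text \<open>\<open>emeasure_early_stop_le\<close> is used with b = (I + \<epsilon>) L. Its last term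
  vanishes by \<open>llr_max_tendsto_0\<close>; in the other one \<open>T\<close> enters only
  through its PFA, which makes the bound uniform over the class.\<close>

lemma early_stop_eventually:
  assumes sm: "\<And>\<epsilon>. 0 < \<epsilon> \<Longrightarrow> (\<Sum>j. emeasure (P k) (llr_deviation I \<epsilon> k (Suc j))) < \<infinity>"
    and cdf: "\<And>n. prior_cdf \<nu> n < 1"
    and lim: "(\<lambda>n. \<bar>ln (1 - prior_cdf \<nu> n)\<bar> / real n) \<longlonglongrightarrow> \<mu>"
    and I: "0 < I" and \<mu>: "0 \<le> \<mu>" and \<delta>: "0 < \<delta>" "\<delta> < 1" and \<eta>: "0 < \<eta>"
  shows "\<forall>\<^sub>F \<alpha> in at_right 0. \<forall>T\<in>PFA_class M N X \<nu> Pinf \<alpha>.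
    emeasure (P k) {\<omega> \<in> space M. enat k < T \<omega> \<and> T \<omega> \<le> enat (k + early_horizon \<delta> (I + \<mu>) \<alpha>)} \<le> ennreal \<eta>"
proof -
  interpret Pk: prob_space "P k" by (rule prob_P)
  \<comment> \<open>Chosen so that I + \<mu> + 2 \<epsilon> = (1 + \<delta>) (I + \<mu>): one
    \<epsilon> is spent on the likelihood ratio and one on the prior tail.\<close>
  define \<epsilon> where "\<epsilon> = \<delta> * (I + \<mu>) / 2"
  have \<epsilon>: "0 < \<epsilon>" using I \<mu> \<delta> by (simp add: \<epsilon>_def)
  let ?L = "early_horizon \<delta> (I + \<mu>)"
  have L: "filterlim ?L sequentially (at_right 0)"
    by (rule filterlim_early_horizon) (use I \<mu> \<delta> in auto)
  let ?U = "\<lambda>L. \<Union>j<L. {\<omega> \<in> space M. (I + \<epsilon>) * real L < log_likelihood_sum g f X k (Suc j) \<omega>}"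
  have "\<forall>\<^sub>F L in sequentially. Pk.prob (?U L) < \<eta> / 2"
    using order_tendstoD(2)[OF llr_max_tendsto_0[OF sm[OF \<epsilon>] I \<epsilon>], of "\<eta> / 2"] \<eta> by simp
  then have ev1: "\<forall>\<^sub>F \<alpha> in at_right 0. Pk.prob (?U (?L \<alpha>)) < \<eta> / 2"
    using L by (rule eventually_compose_filterlim)
  have "\<forall>\<^sub>F n in sequentially. exp (- (\<mu> + \<epsilon>) * real n) \<le> measure_pmf.prob \<nu> {int n..}"
    by (rule prior_tail_exp_lower_bound[OF cdf lim \<mu>]) (use \<epsilon> in simp)
  moreover have "filterlim (\<lambda>\<alpha>. k + ?L \<alpha>) sequentially (at_right 0)"
    using L by (rule filterlim_at_top_mono) simp
  ultimately have ev2: "\<forall>\<^sub>F \<alpha> in at_right 0. exp (- (\<mu> + \<epsilon>) * real (k + ?L \<alpha>)) \<le>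
      measure_pmf.prob \<nu> {int (k + ?L \<alpha>)..}"
    by (rule eventually_compose_filterlim)
  have "((\<lambda>\<alpha>. exp ((\<mu> + \<epsilon>) * real k + \<delta>\<^sup>2 * ln \<alpha>)) \<longlongrightarrow> 0) (at_right 0)"
    using \<delta> by real_asymp
  then have ev3: "\<forall>\<^sub>F \<alpha> in at_right 0. exp ((\<mu> + \<epsilon>) * real k + \<delta>\<^sup>2 * ln \<alpha>) < \<eta> / 2"
    by (rule order_tendstoD) (use \<eta> in simp)
  have ev4: "\<forall>\<^sub>F \<alpha> in at_right 0. \<alpha> \<in> {0<..<1::real}"
    by (rule eventually_at_right_real) simp
  from ev1 ev2 ev3 ev4 show ?thesis
  proof eventually_elim
    case (elim \<alpha>)
    let ?N = "k + ?L \<alpha>"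
    let ?c = "measure_pmf.prob \<nu> {int ?N..}"
    show ?case
    proof
      fix T assume "T \<in> PFA_class M N X \<nu> Pinf \<alpha>"
      then have T: "T \<in> detection_procedures M N X" and PFA: "PFA \<nu> Pinf T \<le> ennreal \<alpha>"
        by (auto simp: PFA_class_def)
      let ?e = "emeasure Pinf {\<omega> \<in> space M. T \<omega> \<le> enat ?N}"
      have "ennreal (exp (- (\<mu> + \<epsilon>) * real ?N)) * ?e \<le> ennreal ?c * ?e"
        using elim(2) by (intro mult_right_mono ennreal_leI) auto
      also have "\<dots> \<le> ennreal \<alpha>" using PFA_ge[OF T, of \<nu> ?N] PFA by simp
      finally have "ennreal (exp ((\<mu> + \<epsilon>) * real ?N)) * (ennreal (exp (- (\<mu> + \<epsilon>) * real ?N)) * ?e) \<le>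
          ennreal (exp ((\<mu> + \<epsilon>) * real ?N)) * ennreal \<alpha>"
        by (rule mult_left_mono) simp
      moreover have "ennreal (exp ((\<mu> + \<epsilon>) * real ?N)) * ennreal (exp (- (\<mu> + \<epsilon>) * real ?N)) = 1"
        by (subst ennreal_mult[symmetric]) (auto simp: algebra_simps simp flip: exp_add)
      ultimately have e: "?e \<le> ennreal (exp ((\<mu> + \<epsilon>) * real ?N) * \<alpha>)"
        using elim(4) by (simp only: mult.assoc[symmetric] mult_1 ennreal_mult exp_ge_zero greaterThanLessThan_iff less_imp_le)
      have "real (?L \<alpha>) \<le> (1 - \<delta>) * \<bar>ln \<alpha>\<bar> / (I + \<mu>)"
        using I \<mu> \<delta> unfolding early_horizon_def
        by (intro of_nat_floor divide_nonneg_pos mult_nonneg_nonneg) auto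
      then have "(I + \<mu>) * real (?L \<alpha>) \<le> (1 - \<delta>) * (- ln \<alpha>)"
        using I \<mu> elim(4) by (simp add: field_simps)
      moreover have e2: "(1 + \<delta>) * ((I + \<mu>) * real (?L \<alpha>)) = (I + \<mu> + 2 * \<epsilon>) * real (?L \<alpha>)"
        by (simp add: \<epsilon>_def algebra_simps)
      ultimately have "(1 + \<delta>) * ((I + \<mu>) * real (?L \<alpha>)) \<le> (1 + \<delta>) * ((1 - \<delta>) * (- ln \<alpha>))"
        using \<delta> by (intro mult_left_mono) auto
      \<comment> \<open>The exponents total at most (1 + \<delta>) (1 - \<delta>) |ln \<alpha>| + ln
        \<alpha> = \<delta>^2 ln \<alpha>, plus a constant depending on \<open>k\<close>.\<close>
      then have "(I + \<epsilon>) * real (?L \<alpha>) + (\<mu> + \<epsilon>) * real ?N + ln \<alpha> \<le> (\<mu> + \<epsilon>) * real k + \<delta>\<^sup>2 * ln \<alpha>"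
        unfolding e2 by (simp add: algebra_simps power2_eq_square)
      then have "exp ((I + \<epsilon>) * real (?L \<alpha>) + (\<mu> + \<epsilon>) * real ?N + ln \<alpha>) \<le> \<eta> / 2"
        using elim(3) by (meson exp_le_cancel_iff less_imp_le order_trans)
      then have exp_le: "exp ((I + \<epsilon>) * real (?L \<alpha>)) * (exp ((\<mu> + \<epsilon>) * real ?N) * \<alpha>) \<le> \<eta> / 2"
        using elim(4) by (simp add: exp_add mult.assoc)
      have "emeasure (P k) {\<omega> \<in> space M. enat k < T \<omega> \<and> T \<omega> \<le> enat ?N} \<le>
          ennreal (exp ((I + \<epsilon>) * real (?L \<alpha>))) * ?e + emeasure (P k) (?U (?L \<alpha>))"
        by (rule emeasure_early_stop_le[OF T])
      also have "\<dots> \<le> ennreal (exp ((I + \<epsilon>) * real (?L \<alpha>))) * ennreal (exp ((\<mu> + \<epsilon>) * real ?N) * \<alpha>) +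
          ennreal (\<eta> / 2)"
        using elim(1) e by (intro add_mono mult_left_mono) (auto simp: Pk.emeasure_eq_measure intro: ennreal_leI)
      also have "\<dots> \<le> ennreal (\<eta> / 2) + ennreal (\<eta> / 2)"
        using exp_le elim(4) by (intro add_right_mono) (simp add: ennreal_leI flip: ennreal_mult)
      also have "\<dots> = ennreal \<eta>" using \<eta> by (simp flip: ennreal_plus)
      finally show "emeasure (P k) {\<omega> \<in> space M. enat k < T \<omega> \<and> T \<omega> \<le> enat ?N} \<le> ennreal \<eta>" .
    qed
  qed
qed

text \<open>How small \<alpha> must be depends on \<open>k\<close>. The prior beyond some
  \<open>K\<close> has mass below \<eta> / 2, whatever the procedure does there, and finitely many
  indices can be handled simultaneously.\<close>

lemma early_stop_sum_eventually:
  assumes sm: "\<And>k \<epsilon>. 0 < prior_mass \<nu> k \<Longrightarrow> 0 < \<epsilon> \<Longrightarrow>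
      (\<Sum>j. emeasure (P k) (llr_deviation I \<epsilon> k (Suc j))) < \<infinity>"
    and cdf: "\<And>n. prior_cdf \<nu> n < 1"
    and lim: "(\<lambda>n. \<bar>ln (1 - prior_cdf \<nu> n)\<bar> / real n) \<longlonglongrightarrow> \<mu>"
    and I: "0 < I" and \<mu>: "0 \<le> \<mu>" and \<delta>: "0 < \<delta>" "\<delta> < 1" and \<eta>: "0 < \<eta>"
  shows "\<forall>\<^sub>F \<alpha> in at_right 0. \<forall>T\<in>PFA_class M N X \<nu> Pinf \<alpha>.
    (\<Sum>k. ennreal (prior_mass \<nu> k) * emeasure (P k)
      {\<omega> \<in> space M. enat k < T \<omega> \<and> T \<omega> \<le> enat (k + early_horizon \<delta> (I + \<mu>) \<alpha>)}) \<le> ennreal \<eta>"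
proof -
  define e where "e k T \<alpha> = emeasure (P k)
    {\<omega> \<in> space M. enat k < T \<omega> \<and> T \<omega> \<le> enat (k + early_horizon \<delta> (I + \<mu>) \<alpha>)}" for k T \<alpha>
  obtain K where K: "norm (\<Sum>j. prior_mass \<nu> (j + K)) < \<eta> / 2"
    using suminf_exist_split[OF _ prior_mass_summable, of "\<eta> / 2"] \<eta> by (meson half_gt_zero order_refl)
  have tail: "(\<Sum>j. ennreal (prior_mass \<nu> (j + K))) \<le> ennreal (\<eta> / 2)"
    using K summable_ignore_initial_segment[OF prior_mass_summable]
    by (subst suminf_ennreal2) (auto intro: ennreal_leI)
  have "\<forall>\<^sub>F \<alpha> in at_right 0. \<forall>T\<in>PFA_class M N X \<nu> Pinf \<alpha>.
      ennreal (prior_mass \<nu> k) * e k T \<alpha> \<le> ennreal (prior_mass \<nu> k) * ennreal (\<eta> / 2)" for k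
  proof (cases "prior_mass \<nu> k = 0")
    case False
    then have "0 < prior_mass \<nu> k" using prior_mass_nonneg[of \<nu> k] by linarith
    then have "\<forall>\<^sub>F \<alpha> in at_right 0. \<forall>T\<in>PFA_class M N X \<nu> Pinf \<alpha>. e k T \<alpha> \<le> ennreal (\<eta> / 2)"
      unfolding e_def by (intro early_stop_eventually[OF sm cdf lim I \<mu> \<delta>]) (use \<eta> in auto)
    then show ?thesis by eventually_elim (auto intro!: mult_left_mono)
  qed simp
  then have "\<forall>\<^sub>F \<alpha> in at_right 0. \<forall>k\<in>{..<K}. \<forall>T\<in>PFA_class M N X \<nu> Pinf \<alpha>.
      ennreal (prior_mass \<nu> k) * e k T \<alpha> \<le> ennreal (prior_mass \<nu> k) * ennreal (\<eta> / 2)"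
    by (intro eventually_ball_finite) auto
  then show ?thesis
    unfolding e_def[symmetric]
  proof eventually_elim
    case (elim \<alpha>)
    show ?case
    proof
      fix T assume T: "T \<in> PFA_class M N X \<nu> Pinf \<alpha>"
      let ?u = "\<lambda>k. ennreal (prior_mass \<nu> k) * e k T \<alpha>"
      have "(\<Sum>k. ?u k) = (\<Sum>k. ?u (k + K)) + (\<Sum>k<K. ?u k)" by (rule suminf_offset) simp
      also have "(\<Sum>k. ?u (k + K)) \<le> (\<Sum>k. ennreal (prior_mass \<nu> (k + K)) * 1)"
        unfolding e_def
        by (intro suminf_le mult_left_mono prob_space.emeasure_le_1 prob_P) auto
      also have "\<dots> \<le> ennreal (\<eta> / 2)" using tail by simp
      also have "(\<Sum>k<K. ?u k) \<le> (\<Sum>k<K. ennreal (prior_mass \<nu> k) * ennreal (\<eta> / 2))"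
        using elim T by (intro sum_mono) auto
      also have "\<dots> \<le> (\<Sum>k. ennreal (prior_mass \<nu> k)) * ennreal (\<eta> / 2)"
        unfolding sum_distrib_right[symmetric] by (intro mult_right_mono sum_le_suminf) auto
      also have "\<dots> \<le> 1 * ennreal (\<eta> / 2)"
        unfolding suminf_prior_mass by (intro mult_right_mono) auto
      also have "ennreal (\<eta> / 2) + 1 * ennreal (\<eta> / 2) = ennreal \<eta>"
        using \<eta> by (simp flip: ennreal_plus)
      finally show "(\<Sum>k. ?u k) \<le> ennreal \<eta>" by (simp add: add_left_mono add_right_mono)
    qed
  qed
qed

text \<open>The complement T \<le> \<open>k\<close> is decided by pre-change observations. The case
  \<open>k = 0\<close> stands apart since there the event T \<le> 0 is empty and the change of
  measure starts at time 1.\<close>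

lemma emeasure_P_T_gt:
  assumes T: "T \<in> detection_procedures M N X"
  shows "emeasure (P k) {\<omega> \<in> space M. enat k < T \<omega>} = emeasure Pinf {\<omega> \<in> space M. enat k < T \<omega>}"
proof -
  have eq: "emeasure (P k) {\<omega> \<in> space M. T \<omega> \<le> enat k} = emeasure Pinf {\<omega> \<in> space M. T \<omega> \<le> enat k}"
  proof (cases "k = 0")
    case True
    then show ?thesis unfolding True emeasure_T_le_0[OF T] by simp
  next
    case False
    then show ?thesis by (intro emeasure_P_pre_change[of k] detection_procedure_le[OF T]) auto
  qed
  have fin: "emeasure Pinf {\<omega> \<in> space M. T \<omega> \<le> enat k} \<noteq> \<infinity>"
    using finite_measure.emeasure_finite[OF prob_space.finite_measure[OF prob_Pinf(1)]] by simp
  have "emeasure Pinf {\<omega> \<in> space M. T \<omega> \<le> enat k} + emeasure (P k) {\<omega> \<in> space M. enat k < T \<omega>} =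
      emeasure Pinf {\<omega> \<in> space M. T \<omega> \<le> enat k} + emeasure Pinf {\<omega> \<in> space M. enat k < T \<omega>}"
    using emeasure_T_gt[OF T prob_Pinf, of k] emeasure_T_gt[OF T prob_P, of k k]
    by (simp only: eq add.commute)
  with fin show ?thesis by (simp add: ennreal_add_left_cancel)
qed

text \<open>Markov's inequality on the late alarms. The early ones are added on the right rather
  than subtracted on the left, which is safe in the extended reals.\<close>

lemma delay_integral_ge:
  assumes T: "T \<in> detection_procedures M N X" and m: "0 < m" and y: "0 \<le> y"
  shows "ennreal (y powr m) * emeasure Pinf {\<omega> \<in> space M. enat k < T \<omega>} \<le>
    (\<integral>\<^sup>+\<omega>. delay_power m k (T \<omega>) \<partial>P k) + ennreal (y powr m) *
      emeasure (P k) {\<omega> \<in> space M. enat k < T \<omega> \<and> T \<omega> \<le> enat (k + nat \<lfloor>y\<rfloor>)}"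
proof -
  let ?n = "k + nat \<lfloor>y\<rfloor>"
  let ?late = "{\<omega> \<in> space M. enat ?n < T \<omega>}"
  let ?early = "{\<omega> \<in> space M. enat k < T \<omega> \<and> T \<omega> \<le> enat ?n}"
  have le: "{\<omega> \<in> space M. T \<omega> \<le> enat j} \<in> sets (P k)" for j
    by (rule sets_obs_filtration_P(2)[OF detection_procedure_le[OF T]])
  have late: "?late = space (P k) - {\<omega> \<in> space M. T \<omega> \<le> enat ?n}"
    and early: "?early = {\<omega> \<in> space M. T \<omega> \<le> enat ?n} - {\<omega> \<in> space M. T \<omega> \<le> enat k}"
    by (auto simp: not_le)
  have sets: "?late \<in> sets (P k)" "?early \<in> sets (P k)" unfolding late early
    by (rule sets.compl_sets[OF le]) (rule sets.Diff[OF le le])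
  have split: "{\<omega> \<in> space M. enat k < T \<omega>} = ?late \<union> ?early"
  proof -
    have "enat k < t" if "enat ?n < t" for t
      using that by (rule le_less_trans[rotated]) simp
    then show ?thesis by (auto simp: not_le)
  qed
  have "ennreal (y powr m) * emeasure (P k) ?late = (\<integral>\<^sup>+\<omega>. ennreal (y powr m) * indicator ?late \<omega> \<partial>P k)"
    using sets by (simp add: nn_integral_cmult_indicator)
  also have "\<dots> \<le> (\<integral>\<^sup>+\<omega>. delay_power m k (T \<omega>) \<partial>P k)"
  proof (rule nn_integral_mono)
    fix \<omega>
    show "ennreal (y powr m) * indicator ?late \<omega> \<le> delay_power m k (T \<omega>)"
    proof (cases "\<omega> \<in> ?late")
      case True
      show ?thesis
      proof (cases "T \<omega>")
        case (enat i)
        \<comment> \<open>Integrality: a delay above the floor of \<open>y\<close> is at least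
          \<open>y\<close>.\<close>
        then have "nat \<lfloor>y\<rfloor> < i - k" using True by auto
        then have "y \<le> real (i - k)" using y by linarith
        then show ?thesis
          using enat True m y by (simp add: delay_power_def ennreal_leI powr_mono2)
      qed (simp add: delay_power_def)
    qed simp
  qed
  finally have "ennreal (y powr m) * emeasure (P k) ?late \<le> (\<integral>\<^sup>+\<omega>. delay_power m k (T \<omega>) \<partial>P k)" .
  moreover have "emeasure (P k) {\<omega> \<in> space M. enat k < T \<omega>} = emeasure (P k) ?late + emeasure (P k) ?early"
    unfolding split using sets by (intro plus_emeasure[symmetric]) auto
  ultimately show ?thesis
    unfolding emeasure_P_T_gt[OF T, symmetric] by (simp add: distrib_left add_right_mono)
qed

text \<open>Early alarms have total weight at most \<delta> h, and h is at most the denominator.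
  Hence the numerator is at least y^m (1 - \<delta>) times the denominator, which cancels.\<close>

lemma delay_moment_eventually_ge:
  assumes sm: "\<And>k \<epsilon>. 0 < prior_mass \<nu> k \<Longrightarrow> 0 < \<epsilon> \<Longrightarrow>
      (\<Sum>j. emeasure (P k) (llr_deviation I \<epsilon> k (Suc j))) < \<infinity>"
    and cdf: "\<And>n. prior_cdf \<nu> n < 1"
    and lim: "(\<lambda>n. \<bar>ln (1 - prior_cdf \<nu> n)\<bar> / real n) \<longlonglongrightarrow> \<mu>"
    and I: "0 < I" and \<mu>: "0 \<le> \<mu>" and q: "prior_neg \<nu> < 1" and m: "0 < m"
    and c: "c < 1 / (I + \<mu>) powr m"
  shows "\<forall>\<^sub>F \<alpha> in at_right 0. \<forall>T\<in>PFA_class M N X \<nu> Pinf \<alpha>.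
    ennreal (c * \<bar>ln \<alpha>\<bar> powr m) \<le> delay_moment \<nu> Pinf P m T"
proof -
  have s: "0 < I + \<mu>" using I \<mu> by simp
  have "((\<lambda>\<delta>. ((1 - \<delta>) / (I + \<mu>)) powr m * (1 - \<delta>)) \<longlongrightarrow> ((1 - 0) / (I + \<mu>)) powr m * (1 - 0)) (at_right 0)"
    using s by (intro tendsto_intros) auto
  then have "\<forall>\<^sub>F \<delta> in at_right 0. c < ((1 - \<delta>) / (I + \<mu>)) powr m * (1 - \<delta>)"
    by (rule order_tendstoD) (use c s in \<open>simp add: powr_divide\<close>)
  moreover have "\<forall>\<^sub>F \<delta> in at_right 0. \<delta> \<in> {0<..<1::real}"
    by (rule eventually_at_right_real) simp
  ultimately have "\<forall>\<^sub>F \<delta> in at_right 0. c < ((1 - \<delta>) / (I + \<mu>)) powr m * (1 - \<delta>) \<and> \<delta> \<in> {0<..<1::real}"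
    by (rule eventually_conj)
  then obtain \<delta> where \<delta>: "0 < \<delta>" "\<delta> < 1" "c < ((1 - \<delta>) / (I + \<mu>)) powr m * (1 - \<delta>)"
    using eventually_happens'[of "at_right (0::real)"] by auto
  \<comment> \<open>For \<alpha> < h the denominator is at least 1 - q - \<alpha> > h.\<close>
  define h where "h = (1 - prior_neg \<nu>) / 2"
  have h: "0 < h" using q by (simp add: h_def)
  have "\<forall>\<^sub>F \<alpha> in at_right 0. \<alpha> \<in> {0<..<h}"
    by (rule eventually_at_right_real) (rule h)
  moreover have "\<forall>\<^sub>F \<alpha> in at_right 0. \<forall>T\<in>PFA_class M N X \<nu> Pinf \<alpha>.
    (\<Sum>k. ennreal (prior_mass \<nu> k) * emeasure (P k)
      {\<omega> \<in> space M. enat k < T \<omega> \<and> T \<omega> \<le> enat (k + early_horizon \<delta> (I + \<mu>) \<alpha>)}) \<le> ennreal (\<delta> * h)"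
    by (rule early_stop_sum_eventually[OF sm cdf lim I \<mu> \<delta>(1,2)]) (use \<delta> h in auto)
  ultimately show ?thesis
  proof eventually_elim
    case (elim \<alpha>)
    show ?case
    proof
      fix T assume TC: "T \<in> PFA_class M N X \<nu> Pinf \<alpha>"
      then have T: "T \<in> detection_procedures M N X" and PFA: "PFA \<nu> Pinf T \<le> ennreal \<alpha>"
        by (auto simp: PFA_class_def)
      define y where "y = (1 - \<delta>) * \<bar>ln \<alpha>\<bar> / (I + \<mu>)"
      have y: "0 \<le> y" using \<delta> s by (simp add: y_def)
      define num where "num = (\<Sum>k. ennreal (prior_mass \<nu> k) * (\<integral>\<^sup>+ \<omega>. delay_power m k (T \<omega>) \<partial>P k))"
      define den where "den = (\<Sum>k. ennreal (prior_mass \<nu> k) * emeasure Pinf {\<omega> \<in> space M. enat k < T \<omega>})"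
      have compl: "den + PFA \<nu> Pinf T = ennreal (1 - prior_neg \<nu>)"
        unfolding den_def by (rule PFA_compl[OF T])
      then obtain d where d: "0 \<le> d" "den = ennreal d"
        by (cases den) auto
      have "ennreal (1 - prior_neg \<nu>) \<le> ennreal d + ennreal \<alpha>"
        using compl d PFA by (metis add_left_mono)
      then have dh: "h \<le> d"
        using d elim by (simp add: h_def flip: ennreal_plus)
      have "ennreal (y powr m) * den \<le> (\<Sum>k. ennreal (prior_mass \<nu> k) *
          ((\<integral>\<^sup>+ \<omega>. delay_power m k (T \<omega>) \<partial>P k) + ennreal (y powr m) * emeasure (P k)
          {\<omega> \<in> space M. enat k < T \<omega> \<and> T \<omega> \<le> enat (k + nat \<lfloor>y\<rfloor>)}))"
        unfolding den_def ennreal_suminf_cmult[symmetric] mult.left_commute[of "ennreal (y powr m)"]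
        by (intro suminf_le mult_left_mono delay_integral_ge T m y) auto
      also have "\<dots> = num + ennreal (y powr m) * (\<Sum>k. ennreal (prior_mass \<nu> k) * emeasure (P k)
          {\<omega> \<in> space M. enat k < T \<omega> \<and> T \<omega> \<le> enat (k + nat \<lfloor>y\<rfloor>)})"
        unfolding num_def ennreal_suminf_cmult[symmetric] mult.left_commute[of "ennreal (y powr m)"]
          distrib_left by (simp add: suminf_add)
      also have "\<dots> \<le> num + ennreal (y powr m) * ennreal (\<delta> * h)"
        using elim(2) TC unfolding early_horizon_def y_def by (intro add_left_mono mult_left_mono) auto
      finally have *: "ennreal (y powr m) * den \<le> num + ennreal (y powr m) * ennreal (\<delta> * h)" .
      have "ennreal (y powr m * (1 - \<delta>)) \<le> num / den"
      proof (cases num)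
        case (real x)
        have "ennreal (y powr m * d) \<le> ennreal (x + y powr m * (\<delta> * h))"
          using * real d \<delta> h by (simp add: ennreal_mult)
        then have "y powr m * d \<le> x + y powr m * (\<delta> * h)"
          using real \<delta> h by (subst (asm) ennreal_le_iff) auto
        moreover have "y powr m * (\<delta> * h) \<le> y powr m * (\<delta> * d)"
          using dh \<delta> by (intro mult_left_mono) auto
        ultimately have "y powr m * (1 - \<delta>) * d \<le> x" by (simp add: algebra_simps)
        then have "y powr m * (1 - \<delta>) \<le> x / d" using dh h by (simp add: field_simps)
        then show ?thesis using real d dh h by (simp add: divide_ennreal ennreal_leI)
      next
        case top
        then show ?thesis using d by (simp add: ennreal_top_divide)
      qed
      moreover have "c * \<bar>ln \<alpha>\<bar> powr m \<le> y powr m * (1 - \<delta>)"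
      proof -
        have "c * \<bar>ln \<alpha>\<bar> powr m \<le> (((1 - \<delta>) / (I + \<mu>)) powr m * (1 - \<delta>)) * \<bar>ln \<alpha>\<bar> powr m"
          using \<delta> by (intro mult_right_mono) auto
        also have "\<dots> = y powr m * (1 - \<delta>)"
          using \<delta> s by (simp add: y_def powr_mult powr_divide)
        finally show ?thesis .
      qed
      ultimately show "ennreal (c * \<bar>ln \<alpha>\<bar> powr m) \<le> delay_moment \<nu> Pinf P m T"
        unfolding delay_moment_def num_def den_def
        by (auto intro: order_trans[OF ennreal_leI])
    qed
  qed
qed

end

section \<open>Asymptotics of the Shiryaev procedure\<close>

lemma ennreal_ratio_tendsto:
  fixes u :: "'a \<Rightarrow> ennreal" and l :: "'a \<Rightarrow> real"
  assumes l: "\<forall>\<^sub>F x in F. 0 < l x" and \<kappa>: "0 \<le> \<kappa>"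
    and lower: "\<And>c. c < \<kappa> \<Longrightarrow> \<forall>\<^sub>F x in F. ennreal (c * l x) \<le> u x"
    and upper: "\<And>c. \<kappa> < c \<Longrightarrow> \<forall>\<^sub>F x in F. u x \<le> ennreal (c * l x)"
  shows "((\<lambda>x. u x / ennreal (l x)) \<longlongrightarrow> ennreal \<kappa>) F"
proof (rule order_tendstoI)
  fix a assume "a < ennreal \<kappa>"
  then obtain b where b: "a < b" "b < ennreal \<kappa>" using dense by blast
  then obtain c where c: "b = ennreal c" "0 \<le> c" by (cases b) auto
  with b have "c < \<kappa>" by (simp add: ennreal_less_iff)
  from lower[OF this] l show "\<forall>\<^sub>F x in F. a < u x / ennreal (l x)"
  proof eventually_elim
    case (elim x)
    have "b = ennreal (c * l x) / ennreal (l x)" using elim c by (simp add: divide_ennreal)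
    also have "\<dots> \<le> u x / ennreal (l x)" using elim by (intro divide_right_mono_ennreal)
    finally show ?case using b by simp
  qed
next
  fix a assume "ennreal \<kappa> < a"
  then obtain b where b: "ennreal \<kappa> < b" "b < a" using dense by blast
  then obtain c where c: "b = ennreal c" "0 \<le> c" by (cases b) auto
  with b have "\<kappa> < c" using \<kappa> by (simp add: ennreal_less_iff)
  from upper[OF this] l show "\<forall>\<^sub>F x in F. u x / ennreal (l x) < a"
  proof eventually_elim
    case (elim x)
    have "u x / ennreal (l x) \<le> ennreal (c * l x) / ennreal (l x)"
      using elim by (intro divide_right_mono_ennreal)
    also have "\<dots> = b" using elim c by (simp add: divide_ennreal)
    finally show ?case using b by simp
  qed
qed

text \<open>Since u \<le> v the quotient is at most 1 once v is neither 0 nor infinite; the bounds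
  with constants 1 / 2 and 2 ensure this.\<close>

lemma ennreal_ratio_tendsto_1:
  fixes u v :: "'a \<Rightarrow> ennreal" and l :: "'a \<Rightarrow> real"
  assumes l: "\<forall>\<^sub>F x in F. 0 < l x" and uv: "\<forall>\<^sub>F x in F. u x \<le> v x"
    and lower: "\<And>c. c < 1 \<Longrightarrow> \<forall>\<^sub>F x in F. ennreal (c * l x) \<le> u x"
    and upper: "\<And>c. 1 < c \<Longrightarrow> \<forall>\<^sub>F x in F. v x \<le> ennreal (c * l x)"
  shows "((\<lambda>x. u x / v x) \<longlongrightarrow> 1) F"
proof (rule order_tendstoI)
  fix a :: ennreal assume "1 < a"
  from lower[of "1 / 2", simplified] upper[of 2, simplified] l uv show "\<forall>\<^sub>F x in F. u x / v x < a"
  proof eventually_elim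
    case (elim x)
    then have "0 < ennreal (l x / 2)" "ennreal (l x / 2) \<le> v x" by auto
    then have "v x \<noteq> 0" by (metis leD)
    moreover have "v x \<noteq> top" using elim(2) by (metis ennreal_neq_top top.extremum_uniqueI)
    ultimately have "u x / v x \<le> 1"
      using divide_right_mono_ennreal[OF elim(4), of "v x"] by (simp add: ennreal_divide_self top.not_eq_extremum)
    then show ?case using \<open>1 < a\<close> by simp
  qed
next
  fix a :: ennreal assume "a < 1"
  then obtain t where t: "a = ennreal t" "0 \<le> t" "t < 1" by (cases a) auto
  \<comment> \<open>The factor 1 / 4 leaves room: e (1 + t) \<le> 2 e = (1 - t) / 2 < 1 - t, which
    rearranges to t (1 + e) < 1 - e.\<close>
  define e where "e = (1 - t) / 4"
  have e: "0 < e" "e < 1" "t * (1 + e) < 1 - e"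
  proof -
    have "e * (1 + t) \<le> e * 2" using t by (intro mult_left_mono) (auto simp: e_def)
    then show "t * (1 + e) < 1 - e" using t by (simp add: e_def field_simps)
  qed (use t in \<open>auto simp: e_def\<close>)
  have "1 - e < 1" "1 < 1 + e" using e by auto
  from lower[OF this(1)] upper[OF this(2)] l uv show "\<forall>\<^sub>F x in F. a < u x / v x"
  proof eventually_elim
    case (elim x)
    have pos: "0 < (1 - e) * l x" using elim e by simp
    have "v x \<noteq> top" using elim(2) by (metis ennreal_neq_top top.extremum_uniqueI)
    then obtain w where w: "v x = ennreal w" "0 \<le> w" by (cases "v x") auto
    have "ennreal ((1 - e) * l x) \<le> ennreal w"
      using order_trans[OF elim(1,4)] w by (simp only:)
    then have w0: "0 < w" using pos w by (simp add: ennreal_le_iff)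
    have "w \<le> (1 + e) * l x" using elim w e by (simp add: ennreal_le_iff)
    then have "t * w \<le> t * ((1 + e) * l x)" using t by (intro mult_left_mono) auto
    also have "\<dots> = t * (1 + e) * l x" by simp
    also have "\<dots> < (1 - e) * l x" using e(3) elim by (intro mult_strict_right_mono) auto
    finally have "t < (1 - e) * l x / w" using w0 by (simp add: field_simps)
    then have "a < ennreal ((1 - e) * l x / w)" using t by (simp add: ennreal_lessI)
    also have "\<dots> = ennreal ((1 - e) * l x) / v x" using w w0 pos by (simp add: divide_ennreal)
    also have "\<dots> \<le> u x / v x" using elim by (intro divide_right_mono_ennreal)
    finally show ?case .
  qed
qed

context change_point_model
begin

lemma delay_moment_shiryaev_eventually_le:
  assumes m: "0 < m" "m \<le> r" "1 \<le> r" and I: "0 < I" and \<mu>: "0 \<le> \<mu>" and q: "prior_neg \<nu> < 1"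
    and cdf: "\<And>n. prior_cdf \<nu> n < 1"
    and lim: "(\<lambda>n. \<bar>ln (1 - prior_cdf \<nu> n)\<bar> / real n) \<longlonglongrightarrow> \<mu>"
    and log_moment: "summable (\<lambda>k. prior_mass \<nu> k * \<bar>ln (prior_mass \<nu> k)\<bar> powr r)"
    and rc: "\<And>\<epsilon>. 0 < \<epsilon> \<Longrightarrow> (\<Sum>k. ennreal (prior_mass \<nu> k) *
         (\<Sum>j. ennreal (real (Suc j) powr (r - 1)) * emeasure (P k) (llr_deviation I \<epsilon> k (Suc j)))) < \<infinity>"
    and c: "1 / (I + \<mu>) powr m < c"
  shows "\<forall>\<^sub>F A in at_top. delay_moment \<nu> Pinf P m (shiryaev_time \<nu> g f X A) \<le> ennreal (c * ln A powr m)"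
proof -
  let ?T = "shiryaev_time \<nu> g f X"
  have s: "0 < I + \<mu>" using I \<mu> by simp
  \<comment> \<open>The square collects two losses: one factor from detaching ln A, the other from
    lowering I and \<mu>.\<close>
  have "((\<lambda>\<delta>. ((1 + \<delta>)\<^sup>2 / (I + \<mu>)) powr m) \<longlongrightarrow> ((1 + 0)\<^sup>2 / (I + \<mu>)) powr m) (at_right 0)"
    using s by (intro tendsto_intros) auto
  then have "\<forall>\<^sub>F \<delta> in at_right 0. ((1 + \<delta>)\<^sup>2 / (I + \<mu>)) powr m < c"
    by (rule order_tendstoD) (use c s in \<open>simp add: powr_divide\<close>)
  moreover have "\<forall>\<^sub>F \<delta> in at_right 0. \<delta> \<in> {0<..<1::real}"
    by (rule eventually_at_right_real) simp
  ultimately have "\<forall>\<^sub>F \<delta> in at_right 0. ((1 + \<delta>)\<^sup>2 / (I + \<mu>)) powr m < c \<and> \<delta> \<in> {0<..<1::real}"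
    by (rule eventually_conj)
  then obtain \<delta> where \<delta>: "0 < \<delta>" "((1 + \<delta>)\<^sup>2 / (I + \<mu>)) powr m < c"
    using eventually_happens'[of "at_right (0::real)"] by auto
  define \<kappa> where "\<kappa> = ((1 + \<delta>)\<^sup>2 / (I + \<mu>)) powr m"
  have I': "0 < I / (1 + \<delta>)" "I / (1 + \<delta>) < I" "0 \<le> \<mu> / (1 + \<delta>)"
    "\<mu> / (1 + \<delta>) < \<mu> \<or> \<mu> / (1 + \<delta>) = 0"
    using I \<mu> \<delta> by (auto simp: field_simps)
  obtain K where K: "0 \<le> K" "\<And>A. 1 \<le> A \<Longrightarrow>
    (\<Sum>k. ennreal (prior_mass \<nu> k) * (\<integral>\<^sup>+\<omega>. delay_power m k (?T A \<omega>) \<partial>P k)) \<le>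
    ennreal ((1 - prior_neg \<nu>) * ((1 + \<delta>) * ln A / (I / (1 + \<delta>) + \<mu> / (1 + \<delta>))) powr m + K)"
    using shiryaev_delay_sum_le[OF m \<delta>(1) I' cdf lim log_moment rc] by blast
  let ?h = "1 - prior_neg \<nu>"
  \<comment> \<open>The prior mass \<open>?h\<close> in the numerator cancels against the limit of
    the denominator, and \<open>K\<close> vanishes relative to the power of ln A.\<close>
  have "((\<lambda>A. (?h * \<kappa> + K / ln A powr m) / (?h - 1 / (1 + A))) \<longlongrightarrow> (?h * \<kappa> + 0) / (?h - 0)) at_top"
  proof (intro tendsto_intros)
    show "((\<lambda>A. K / ln A powr m) \<longlongrightarrow> 0) at_top" using m by real_asymp
    show "((\<lambda>A::real. 1 / (1 + A)) \<longlongrightarrow> 0) at_top" by real_asymp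
  qed (use q in auto)
  then have ev1: "\<forall>\<^sub>F A in at_top. (?h * \<kappa> + K / ln A powr m) / (?h - 1 / (1 + A)) < c"
    by (rule order_tendstoD) (use q \<delta> in \<open>simp add: \<kappa>_def\<close>)
  have "((\<lambda>A::real. 1 / (1 + A)) \<longlongrightarrow> 0) at_top" by real_asymp
  then have ev2: "\<forall>\<^sub>F A in at_top. 1 / (1 + A) < ?h"
    by (rule order_tendstoD) (use q in simp)
  from ev1 ev2 eventually_gt_at_top[of "1::real"] show ?thesis
  proof eventually_elim
    case (elim A)
    note T = shiryaev_time_detection_procedure[of \<nu> A]
    define den where "den = (\<Sum>k. ennreal (prior_mass \<nu> k) * emeasure Pinf {\<omega> \<in> space M. enat k < ?T A \<omega>})"
    define x where "x = ?h * ((1 + \<delta>) * ln A / (I / (1 + \<delta>) + \<mu> / (1 + \<delta>))) powr m + K"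
    have L: "0 < ln A" using elim by simp
    have x: "x = (?h * \<kappa> + K / ln A powr m) * ln A powr m" "0 \<le> x"
    proof -
      have eq: "(1 + \<delta>) * ln A / (I / (1 + \<delta>) + \<mu> / (1 + \<delta>)) = (1 + \<delta>)\<^sup>2 / (I + \<mu>) * ln A"
        using \<delta> s by (simp add: power2_eq_square flip: add_divide_distrib)
      have "((1 + \<delta>) * ln A / (I / (1 + \<delta>) + \<mu> / (1 + \<delta>))) powr m = \<kappa> * ln A powr m"
        unfolding eq \<kappa>_def using L s by (simp add: powr_mult del: times_divide_eq_left)
      then show "x = (?h * \<kappa> + K / ln A powr m) * ln A powr m"
        using L unfolding x_def by (simp add: distrib_right)
      show "0 \<le> x" using K q unfolding x_def by simp
    qed
    have compl: "den + PFA \<nu> Pinf (?T A) = ennreal ?h"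
      unfolding den_def by (rule PFA_compl[OF T])
    then obtain d where d: "0 \<le> d" "den = ennreal d" by (cases den) auto
    have "ennreal ?h \<le> ennreal d + ennreal (1 / (1 + A))"
      using compl d PFA_shiryaev_time[of A \<nu>] cdf elim by (metis add_left_mono less_imp_le less_trans zero_less_one)
    then have "ennreal ?h \<le> ennreal (d + 1 / (1 + A))"
      using d elim by simp
    then have "?h \<le> d + 1 / (1 + A)"
      using d elim by (subst (asm) ennreal_le_iff) auto
    then have dh: "?h - 1 / (1 + A) \<le> d" by simp
    have "delay_moment \<nu> Pinf P m (?T A) \<le> ennreal x / den"
      unfolding delay_moment_def den_def x_def using K(2)[of A] elim
      by (auto intro: divide_right_mono_ennreal)
    also have "\<dots> = ennreal (x / d)" using d dh elim x by (simp add: divide_ennreal)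
    also have "x / d \<le> x / (?h - 1 / (1 + A))"
      using x dh elim by (intro divide_left_mono mult_pos_pos) auto
    also have "\<dots> = (?h * \<kappa> + K / ln A powr m) / (?h - 1 / (1 + A)) * ln A powr m"
      unfolding x(1) by simp
    also have "\<dots> \<le> c * ln A powr m" using elim by (intro mult_right_mono) auto
    finally show ?case by (simp add: ennreal_leI)
  qed
qed

text \<open>For \<pi>_k > 0 the weighted double sum controls each inner sum, and r \<ge> 1 makes its
  weights at least 1.\<close>

lemma deviation_summable:
  assumes r: "1 \<le> r" and pk: "0 < prior_mass \<nu> k"
    and rc: "(\<Sum>k. ennreal (prior_mass \<nu> k) *
         (\<Sum>j. ennreal (real (Suc j) powr (r - 1)) * emeasure (P k) (llr_deviation I \<epsilon> k (Suc j)))) < \<infinity>"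
  shows "(\<Sum>j. emeasure (P k) (llr_deviation I \<epsilon> k (Suc j))) < \<infinity>"
proof -
  define R where "R k = (\<Sum>j. ennreal (real (Suc j) powr (r - 1)) *
    emeasure (P k) (llr_deviation I \<epsilon> k (Suc j)))" for k
  have "(\<Sum>j. emeasure (P k) (llr_deviation I \<epsilon> k (Suc j))) \<le> R k"
    unfolding R_def
  proof (intro suminf_le)
    fix j
    have "1 \<le> ennreal (real (Suc j) powr (r - 1))"
      using r by (simp add: ge_one_powr_ge_zero)
    then have "1 * emeasure (P k) (llr_deviation I \<epsilon> k (Suc j)) \<le>
        ennreal (real (Suc j) powr (r - 1)) * emeasure (P k) (llr_deviation I \<epsilon> k (Suc j))"
      by (rule mult_right_mono) simp
    then show "emeasure (P k) (llr_deviation I \<epsilon> k (Suc j)) \<le>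
        ennreal (real (Suc j) powr (r - 1)) * emeasure (P k) (llr_deviation I \<epsilon> k (Suc j))" by simp
  qed auto
  also have "R k < \<infinity>"
  proof -
    have "ennreal (prior_mass \<nu> k) * R k \<le> (\<Sum>k. ennreal (prior_mass \<nu> k) * R k)"
      using sum_le_suminf[of "\<lambda>k. ennreal (prior_mass \<nu> k) * R k" "{k}"] by simp
    also have "\<dots> < \<infinity>" using rc unfolding R_def .
    finally show ?thesis using pk by (auto simp: ennreal_mult_less_top)
  qed
  finally show ?thesis .
qed

lemma shiryaev_time_PFA_class:
  assumes "0 < \<alpha>" "\<alpha> < 1" and cdf: "\<And>n. prior_cdf \<nu> n < 1"
  shows "shiryaev_time \<nu> g f X ((1 - \<alpha>) / \<alpha>) \<in> PFA_class M N X \<nu> Pinf \<alpha>"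
proof -
  have "1 / (1 + (1 - \<alpha>) / \<alpha>) = \<alpha>" using assms by (simp add: field_simps)
  then show ?thesis
    using PFA_shiryaev_time[of "(1 - \<alpha>) / \<alpha>" \<nu>] assms shiryaev_time_detection_procedure
    by (simp add: PFA_class_def)
qed

end

theorem corollary3p1:
  fixes M :: "'w measure" and N :: "'s measure" and X :: "nat \<Rightarrow> 'w \<Rightarrow> 's"
    and Pinf :: "'w measure" and P :: "nat \<Rightarrow> 'w measure"
    and g :: "nat \<Rightarrow> (nat \<Rightarrow> 's) \<Rightarrow> 's \<Rightarrow> real"
    and f :: "nat \<Rightarrow> nat \<Rightarrow> (nat \<Rightarrow> 's) \<Rightarrow> 's \<Rightarrow> real"
    and \<nu> :: "int pmf" and r \<mu> I :: real
  assumes model: "change_point_model M N X Pinf P g f"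
    and q: "prior_neg \<nu> < 1"
    and r: "1 \<le> r"
    and mu: "0 \<le> \<mu>"
    and prior_lt_1: "\<And>n. prior_cdf \<nu> n < 1"
    and prior_tail: "(\<lambda>n. \<bar>ln (1 - prior_cdf \<nu> n)\<bar> / real n) \<longlonglongrightarrow> \<mu>"
    and prior_log_moment:
      "\<mu> = 0 \<Longrightarrow> summable (\<lambda>k. prior_mass \<nu> k * \<bar>ln (prior_mass \<nu> k)\<bar> powr r)"
    and I: "0 < I"
    and r_complete: "\<And>\<epsilon>. 0 < \<epsilon> \<Longrightarrow>
      (\<Sum>k. ennreal (prior_mass \<nu> k) *
         (\<Sum>j. ennreal (real (Suc j) powr (r - 1)) *
            emeasure (P k) {\<omega> \<in> space (P k).
              \<bar>1 / real (Suc j) * log_likelihood_sum g f X k (Suc j) \<omega> - I\<bar> > \<epsilon>})) < \<infinity>"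
  shows
    "(\<forall>m. 0 < m \<and> m \<le> r \<longrightarrow>
        ((\<lambda>A. delay_moment \<nu> Pinf P m (shiryaev_time \<nu> g f X A) / ennreal (ln A powr m))
           \<longlongrightarrow> ennreal (1 / (I + \<mu>) powr m)) at_top) \<and>
     (\<forall>m. 0 < m \<and> m \<le> r \<longrightarrow>
        ((\<lambda>\<alpha>. (INF T\<in>PFA_class M N X \<nu> Pinf \<alpha>. delay_moment \<nu> Pinf P m T) /
               delay_moment \<nu> Pinf P m (shiryaev_time \<nu> g f X ((1 - \<alpha>) / \<alpha>)))
           \<longlongrightarrow> 1) (at_right 0) \<and>
        ratio_equiv
          (\<lambda>\<alpha>. INF T\<in>PFA_class M N X \<nu> Pinf \<alpha>. delay_moment \<nu> Pinf P m T)
          (\<lambda>\<alpha>. delay_moment \<nu> Pinf P m (shiryaev_time \<nu> g f X ((1 - \<alpha>) / \<alpha>)))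
          (at_right 0) \<and>
        ratio_equiv
          (\<lambda>\<alpha>. delay_moment \<nu> Pinf P m (shiryaev_time \<nu> g f X ((1 - \<alpha>) / \<alpha>)))
          (\<lambda>\<alpha>. ennreal ((\<bar>ln \<alpha>\<bar> / (I + \<mu>)) powr m))
          (at_right 0))"
proof -
  interpret change_point_model M N X Pinf P g f by (rule model)
  have s: "0 < I + \<mu>" using I mu by simp
  let ?D = "\<lambda>m A. delay_moment \<nu> Pinf P m (shiryaev_time \<nu> g f X A)"
  let ?J = "\<lambda>m \<alpha>. INF T\<in>PFA_class M N X \<nu> Pinf \<alpha>. delay_moment \<nu> Pinf P m T"
  let ?l = "\<lambda>m \<alpha>. (\<bar>ln \<alpha>\<bar> / (I + \<mu>)) powr m"
  have rc: "(\<Sum>k. ennreal (prior_mass \<nu> k) * (\<Sum>j. ennreal (real (Suc j) powr (r - 1)) *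
      emeasure (P k) (llr_deviation I \<epsilon> k (Suc j)))) < \<infinity>" if "0 < \<epsilon>" for \<epsilon>
    using r_complete[OF that] unfolding llr_deviation_def space_P .
  have log_moment: "summable (\<lambda>k. prior_mass \<nu> k * \<bar>ln (prior_mass \<nu> k)\<bar> powr r)"
    using prior_log_moment prior_log_moment_exp[OF prior_lt_1 prior_tail, of r] mu r
    by (cases "\<mu> = 0") auto
  have upper: "\<forall>\<^sub>F A in at_top. ?D m A \<le> ennreal (c * ln A powr m)"
    if "0 < m" "m \<le> r" "1 / (I + \<mu>) powr m < c" for m c
    by (rule delay_moment_shiryaev_eventually_le[OF that(1,2) r I mu q prior_lt_1 prior_tail log_moment rc that(3)])
  have lower: "\<forall>\<^sub>F \<alpha> in at_right 0. \<forall>T\<in>PFA_class M N X \<nu> Pinf \<alpha>.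
      ennreal (c * \<bar>ln \<alpha>\<bar> powr m) \<le> delay_moment \<nu> Pinf P m T"
    if "0 < m" "c < 1 / (I + \<mu>) powr m" for m c
    by (rule delay_moment_eventually_ge[OF deviation_summable[OF r _ rc] prior_lt_1 prior_tail I mu q that])
  \<comment> \<open>For \<alpha> < 1 / 2 the threshold (1 - \<alpha>) / \<alpha> exceeds 1, so its
    logarithm is positive.\<close>
  have inside: "\<forall>\<^sub>F \<alpha> in at_right 0. \<alpha> \<in> {0<..<1/2::real}"
    by (rule eventually_at_right_real) simp
  have "((\<lambda>A. ?D m A / ennreal (ln A powr m)) \<longlongrightarrow> ennreal (1 / (I + \<mu>) powr m)) at_top"
    if m: "0 < m" "m \<le> r" for m
  proof (rule ennreal_ratio_tendsto)
    show "\<forall>\<^sub>F A in at_top. 0 < ln A powr m"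
      using eventually_gt_at_top[of "1::real"] by eventually_elim simp
    fix c assume c: "c < 1 / (I + \<mu>) powr m"
    \<comment> \<open>T_A belongs to the class of level \<alpha> = 1 / (1 + A), and |ln \<alpha>| =
      ln (1 + A) \<ge> ln A, so the uniform lower bound applies to it.\<close>
    have "filterlim (\<lambda>A::real. 1 / (1 + A)) (at_right 0) at_top" by real_asymp
    from eventually_compose_filterlim[OF lower[OF m(1) c] this] eventually_gt_at_top[of "1::real"]
    show "\<forall>\<^sub>F A in at_top. ennreal (c * ln A powr m) \<le> ?D m A"
    proof eventually_elim
      case (elim A)
      show ?case
      proof (cases "0 \<le> c")
        case True
        have "(1 - 1 / (1 + A)) / (1 / (1 + A)) = A" using elim by (simp add: field_simps)
        then have "shiryaev_time \<nu> g f X A \<in> PFA_class M N X \<nu> Pinf (1 / (1 + A))"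
          using shiryaev_time_PFA_class[of "1 / (1 + A)" \<nu>] prior_lt_1 elim by simp
        then have "ennreal (c * \<bar>ln (1 / (1 + A))\<bar> powr m) \<le> ?D m A" using elim by blast
        moreover have "ln A \<le> \<bar>ln (1 / (1 + A))\<bar>" using elim by (simp add: ln_div)
        then have "c * ln A powr m \<le> c * \<bar>ln (1 / (1 + A))\<bar> powr m"
          using True elim m by (intro mult_left_mono powr_mono2) auto
        ultimately show ?thesis using ennreal_leI order_trans by blast
      next
        case False
        then have "c * ln A powr m \<le> 0" by (intro mult_nonpos_nonneg) auto
        then show ?thesis by (simp add: ennreal_neg)
      qed
    qed
  qed (use upper m s in auto)
  moreover have "((\<lambda>\<alpha>. ?J m \<alpha> / ?D m ((1 - \<alpha>) / \<alpha>)) \<longlongrightarrow> 1) (at_right 0) \<and>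
      ((\<lambda>\<alpha>. ?D m ((1 - \<alpha>) / \<alpha>) / ennreal (?l m \<alpha>)) \<longlongrightarrow> ennreal 1) (at_right 0)"
    if m: "0 < m" "m \<le> r" for m
  proof -
    have l_pos: "\<forall>\<^sub>F \<alpha> in at_right 0. 0 < ?l m \<alpha>"
      using inside by eventually_elim (use s in auto)
    have le: "\<forall>\<^sub>F \<alpha> in at_right 0. ?J m \<alpha> \<le> ?D m ((1 - \<alpha>) / \<alpha>)"
      using inside by eventually_elim (intro INF_lower shiryaev_time_PFA_class prior_lt_1, auto)
    \<comment> \<open>For each small \<alpha> the lower bound holds for all members of the class at
      once, hence for the infimum.\<close>
    have J_ge: "\<forall>\<^sub>F \<alpha> in at_right 0. ennreal (c * ?l m \<alpha>) \<le> ?J m \<alpha>" if "c < 1" for c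
    proof -
      have "c / (I + \<mu>) powr m < 1 / (I + \<mu>) powr m" using that s by (simp add: divide_strict_right_mono)
      from lower[OF m(1) this] show ?thesis
        by eventually_elim (use s in \<open>auto intro!: INF_greatest simp: powr_divide\<close>)
    qed
    have D_le: "\<forall>\<^sub>F \<alpha> in at_right 0. ?D m ((1 - \<alpha>) / \<alpha>) \<le> ennreal (c * ?l m \<alpha>)" if "1 < c" for c
    proof -
      have c: "1 / (I + \<mu>) powr m < c / (I + \<mu>) powr m" using that s by (simp add: divide_strict_right_mono)
      have "filterlim (\<lambda>\<alpha>::real. (1 - \<alpha>) / \<alpha>) at_top (at_right 0)" by real_asymp
      from eventually_compose_filterlim[OF upper[OF m c] this] inside show ?thesis
      proof eventually_elim
        case (elim \<alpha>)
        have "0 \<le> ln ((1 - \<alpha>) / \<alpha>)" using elim by (intro ln_ge_zero) (simp add: field_simps)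
        moreover have "ln ((1 - \<alpha>) / \<alpha>) \<le> \<bar>ln \<alpha>\<bar>" using elim by (simp add: ln_div)
        ultimately have "ln ((1 - \<alpha>) / \<alpha>) powr m \<le> \<bar>ln \<alpha>\<bar> powr m" using m by (intro powr_mono2) auto
        then have "c / (I + \<mu>) powr m * ln ((1 - \<alpha>) / \<alpha>) powr m \<le> c / (I + \<mu>) powr m * \<bar>ln \<alpha>\<bar> powr m"
          using that by (intro mult_left_mono) auto
        also have "\<dots> = c * ?l m \<alpha>" using s by (simp add: powr_divide)
        finally show ?case using elim(1) ennreal_leI order_trans by blast
      qed
    qed
    \<comment> \<open>The procedure with threshold (1 - \<alpha>) / \<alpha> belongs to the class
      and inherits the bound on the infimum.\<close>
    have D_ge: "\<forall>\<^sub>F \<alpha> in at_right 0. ennreal (c * ?l m \<alpha>) \<le> ?D m ((1 - \<alpha>) / \<alpha>)" if "c < 1" for c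
      using J_ge[OF that] le by eventually_elim (rule order_trans)
    show ?thesis
      using ennreal_ratio_tendsto_1[OF l_pos le J_ge D_le] ennreal_ratio_tendsto[OF l_pos zero_le_one D_ge D_le]
      by blast
  qed
  ultimately show ?thesis by (simp add: ratio_equiv_def)
qed

end
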